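(* Let $\mathcal C$ be a triangulated category with shift functor $[1]$ and with Auslander–Reiten translation $\tau$, and let $\mathcal X$ be a functorially finite subcategory of $\mathcal C$ which satisfies $\tau\mathcal X=\mathcal X$. For $A,C\in\mathcal C$ let $\mathbb E'(C,A)\subseteq\mathcal C(C,A[1])$ be the collection of those $\delta$ for which, in a triangle $A\xrightarrow{f}B\xrightarrow{g}C\xrightarrow{\delta}A[1]$, the morphism $f$ is $\mathcal X$-monic, and put $\mathfrak s'(\delta)=[A\xrightarrow{f}B\xrightarrow{g}C]$, so that $(\mathcal C,\mathbb E',\mathfrak s')$ is a Frobenius extriangulated category whose projective (= injective) objects are precisely the objects of $\mathcal X$. (a) If $\mathcal X\neq\{0\}$, then the extriangulated category $(\mathcal C,\mathbb E',\mathfrak s')$ is not triangulated. (b) If $\mathcal X\neq\mathcal C$, then the extriangulated category $(\mathcal C,\mathbb E',\mathfrak s')$ is not exact. Consequently, if $\{0\}\neq\mathcal X\subsetneq\mathcal C$, then $(\mathcal C,\mathbb E',\mathfrak s')$ is neither exact nor triangulated.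
   Context: Conventions: $k$ is a field; all categories are Krull–Schmidt $k$-linear categories; all subcategories are full and closed under isomorphisms, direct sums and direct summands. Source morphism $f:A\to B$: $f$ is not a section, every $u:A\to C$ that is not a section factors through $f$, and $\phi f=f$ implies $\phi$ is an automorphism; sink morphisms are dual. An Auslander–Reiten triangle is a triangle $A\xrightarrow{f}B\xrightarrow{g}C\to A[1]$ with $f$ a source and $g$ a sink morphism; then $A,C$ are indecomposable and one writes $A=\tau C$, $C=\tau^{-1}A$. "With Auslander–Reiten translation $\tau$" means every indecomposable object is the end term and the starting term of Auslander–Reiten triangles; $\tau$ is extended additively to all objects. A left $\mathcal X$-approximation of $A$ is a morphism $A\to X$ with $X\in\mathcal X$ through which every morphism from $A$ to an object of $\mathcal X$ factors; right $\mathcal X$-approximations are dual. $\mathcal X$ is functorially finite if every object of $\mathcal C$ has both a left and a right $\mathcal X$-approximation. A morphism $f:A\to B$ is $\mathcal X$-monic if $\mathcal C(f,X):\mathcal C(B,X)\to\mathcal C(A,X)$ is surjective for all $X\in\mathcal X$. Extriangulated category $(\mathcal C,\mathbb E,\mathfrak s)$ (Nakaoka–Palu): $\mathcal C$ is an additive category. (ET1) $\mathbb E:\mathcal C^{op}\times\mathcal C\to\mathrm{Ab}$ is a biadditive functor; elements $\delta\in\mathbb E(C,A)$ are called $\mathbb E$-extensions; for $a:A\to A'$, $c:C'\to C$ write $a_*\delta=\mathbb E(C,a)(\delta)$, $c^*\delta=\mathbb E(c,A)(\delta)$. A morphism $(a,c):\delta\to\delta'$ from $\delta\in\mathbb E(C,A)$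 to $\delta'\in\mathbb E(C',A')$ is a pair $a:A\to A'$, $c:C\to C'$ with $a_*\delta=c^*\delta'$. (ET2) $\mathfrak s$ is an additive realization: it assigns to each $\delta\in\mathbb E(C,A)$ an equivalence class $\mathfrak s(\delta)=[A\xrightarrow{x}B\xrightarrow{y}C]$ of sequences ($A\to B\to C$ and $A\to B'\to C$ are equivalent if there is an isomorphism $B\to B'$ compatible with $\mathrm{id}_A,\mathrm{id}_C$), such that every morphism $(a,c):\delta\to\delta'$ is realized by some $b:B\to B'$ with $bx=x'a$, $y'b=cy$ (where $\mathfrak s(\delta')=[A'\xrightarrow{x'}B'\xrightarrow{y'}C']$), $\mathfrak s(0)=[A\to A\oplus C\to C]$, and $\mathfrak s(\delta\oplus\delta')=\mathfrak s(\delta)\oplus\mathfrak s(\delta')$. (ET3) If $\delta,\delta'$ are realized by $A\xrightarrow{x}B\xrightarrow{y}C$ and $A'\xrightarrow{x'}B'\xrightarrow{y'}C'$ and $bx=x'a$, then there is $c$ with $(a,c):\delta\to\delta'$ a morphism and $cy=y'b$. (ET3)$^{op}$ Dually, if $cy=y'b$ then there is $a$ with $(a,c):\delta\to\delta'$ a morphism and $bx=x'a$. (ET4) If $\delta\in\mathbb E(D,A)$ is realized by $A\xrightarrow{f}B\xrightarrow{f'}D$ and $\delta'\in\mathbb E(F,B)$ by $B\xrightarrow{g}C\xrightarrow{g'}F$, then there are an object $E$, morphisms $h':C\to E$, $d:D\to E$, $e:E\to F$ with $h'g=df'$, $eh'=g'$, and $\delta''\in\mathbb E(E,A)$ realized by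 $A\xrightarrow{gf}C\xrightarrow{h'}E$ such that $D\xrightarrow{d}E\xrightarrow{e}F$ realizes $f'_*\delta'$, $d^*\delta''=\delta$ and $f_*\delta''=e^*\delta'$. (ET4)$^{op}$ If $\delta\in\mathbb E(B,D)$ is realized by $D\xrightarrow{f'}A\xrightarrow{f}B$ and $\delta'\in\mathbb E(C,F)$ by $F\xrightarrow{g'}B\xrightarrow{g}C$, then there are an object $E$, morphisms $d:D\to E$, $e:E\to F$, $h':E\to A$ with $h'd=f'$, $fh'=g'e$, and $\delta''\in\mathbb E(C,E)$ realized by $E\xrightarrow{h'}A\xrightarrow{gf}C$ such that $D\xrightarrow{d}E\xrightarrow{e}F$ realizes $g'^*\delta$, $e_*\delta''=\delta'$ and $d_*\delta=g^*\delta''$. If $A\xrightarrow{x}B\xrightarrow{y}C$ realizes $\delta$, the sequence is called a conflation, $x$ an inflation, $y$ a deflation, and the sequence together with $\delta$ an $\mathbb E$-triangle. In an extriangulated category an object $P$ is projective if for every $\mathbb E$-triangle $A\to B\xrightarrow{y}C\dashrightarrow$ every morphism $P\to C$ factors through $y$; injectives are dual. It is Frobenius if every object $C$ admits $\mathbb E$-triangles $A\to P\to C\dashrightarrow$ with $P$ projective and $C\to I\to D\dashrightarrow$ with $I$ injective, and projectives coincide with injectives. An extriangulated category is called exact if it arises from a Quillen exact category ($\mathbb E=\mathrm{Ext}^1$, conflations = the admissible short exact sequences); equivalently, every inflation is a monomorphism and every deflation is an epimorphism. It is called triangulated if it arises from a triangulated structure on the category with some shift functor $T$, i.e. $\mathbb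 E=\mathrm{Hom}(-,T-)$ with $\delta$ realized by $A\to B\to C$ whenever $A\to B\to C\xrightarrow{\delta}TA$ is a distinguished triangle. *)

theory Defs
  imports "HOL-Algebra.Module"
begin

(* The hom-sets are records of type module; of these only the carrier, the addition, the zero
   and the scalar multiplication are used, the ring multiplication and unit are irrelevant. *)

record ('k, 'o, 'm) lincat =
  Ob  :: "'o set"
  Mor :: "'o \<Rightarrow> 'o \<Rightarrow> ('k, 'm) module"
  Idt :: "'o \<Rightarrow> 'm"
  Cmp :: "'m \<Rightarrow> 'm \<Rightarrow> 'm"

locale cat_data =
  fixes C :: "('k, 'o, 'm) lincat"
begin

abbreviation "Obj \<equiv> Ob C"
abbreviation "Hom A B \<equiv> carrier (Mor C A B)"
abbreviation "idn A \<equiv> Idt C A"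
abbreviation "nul A B \<equiv> \<zero>\<^bsub>Mor C A B\<^esub>"
abbreviation comp (infixr "\<cdot>" 75) where "g \<cdot> f \<equiv> Cmp C g f"

definition section_mor :: "'o \<Rightarrow> 'o \<Rightarrow> 'm \<Rightarrow> bool" where
  "section_mor A B f \<longleftrightarrow> f \<in> Hom A B \<and> (\<exists>g\<in>Hom B A. g \<cdot> f = idn A)"

definition retraction_mor :: "'o \<Rightarrow> 'o \<Rightarrow> 'm \<Rightarrow> bool" where
  "retraction_mor A B f \<longleftrightarrow> f \<in> Hom A B \<and> (\<exists>g\<in>Hom B A. f \<cdot> g = idn B)"

definition iso_mor :: "'o \<Rightarrow> 'o \<Rightarrow> 'm \<Rightarrow> bool" where
  "iso_mor A B f \<longleftrightarrow> f \<in> Hom A B \<and> (\<exists>g\<in>Hom B A. g \<cdot> f = idn A \<and> f \<cdot> g = idn B)"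

definition zero_object :: "'o \<Rightarrow> bool" where
  "zero_object Z \<longleftrightarrow> Z \<in> Obj \<and> idn Z = nul Z Z"

definition biproduct :: "'o \<Rightarrow> 'o \<Rightarrow> 'o \<Rightarrow> 'm \<Rightarrow> 'm \<Rightarrow> 'm \<Rightarrow> 'm \<Rightarrow> bool" where
  "biproduct A B S i j p q \<longleftrightarrow>
     A \<in> Obj \<and> B \<in> Obj \<and> S \<in> Obj \<and>
     i \<in> Hom A S \<and> j \<in> Hom B S \<and> p \<in> Hom S A \<and> q \<in> Hom S B \<and>
     p \<cdot> i = idn A \<and> q \<cdot> j = idn B \<and> p \<cdot> j = nul B A \<and> q \<cdot> i = nul A B \<and>
     (i \<cdot> p) \<oplus>\<^bsub>Mor C S S\<^esub> (j \<cdot> q) = idn S"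

inductive direct_sum :: "'o list \<Rightarrow> 'o \<Rightarrow> bool" where
  "zero_object Z \<Longrightarrow> direct_sum [] Z"
| "direct_sum As B \<Longrightarrow> biproduct A B S i j p q \<Longrightarrow> direct_sum (A # As) S"

definition indecomposable :: "'o \<Rightarrow> bool" where
  "indecomposable S \<longleftrightarrow> S \<in> Obj \<and> \<not> zero_object S \<and>
     (\<forall>A B i j p q. biproduct A B S i j p q \<longrightarrow> zero_object A \<or> zero_object B)"

(* the endomorphism ring of A is nonzero and its non-units are closed under addition *)
definition local_End :: "'o \<Rightarrow> bool" where
  "local_End A \<longleftrightarrow> A \<in> Obj \<and> idn A \<noteq> nul A A \<and>
     (\<forall>f\<in>Hom A A. \<forall>g\<in>Hom A A.
        iso_mor A A (f \<oplus>\<^bsub>Mor C A A\<^esub> g) \<longrightarrow> iso_mor A A f \<or> iso_mor A A g)"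

definition source_mor :: "'o \<Rightarrow> 'o \<Rightarrow> 'm \<Rightarrow> bool" where
  "source_mor A B f \<longleftrightarrow> f \<in> Hom A B \<and> \<not> section_mor A B f \<and>
     (\<forall>D\<in>Obj. \<forall>u\<in>Hom A D. \<not> section_mor A D u \<longrightarrow> (\<exists>v\<in>Hom B D. u = v \<cdot> f)) \<and>
     (\<forall>\<phi>\<in>Hom B B. \<phi> \<cdot> f = f \<longrightarrow> iso_mor B B \<phi>)"

definition sink_mor :: "'o \<Rightarrow> 'o \<Rightarrow> 'm \<Rightarrow> bool" where
  "sink_mor B D g \<longleftrightarrow> g \<in> Hom B D \<and> \<not> retraction_mor B D g \<and>
     (\<forall>A\<in>Obj. \<forall>u\<in>Hom A D. \<not> retraction_mor A D u \<longrightarrow> (\<exists>v\<in>Hom A B. u = g \<cdot> v)) \<and>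
     (\<forall>\<phi>\<in>Hom B B. g \<cdot> \<phi> = g \<longrightarrow> iso_mor B B \<phi>)"

(* Full subcategories are given by their sets of objects. *)

definition subcategory :: "'o set \<Rightarrow> bool" where
  "subcategory X \<longleftrightarrow> X \<subseteq> Obj \<and>
     (\<forall>A B f. A \<in> X \<longrightarrow> B \<in> Obj \<longrightarrow> iso_mor A B f \<longrightarrow> B \<in> X) \<and>
     (\<forall>Z. zero_object Z \<longrightarrow> Z \<in> X) \<and>
     (\<forall>A B S i j p q. biproduct A B S i j p q \<longrightarrow> (S \<in> X \<longleftrightarrow> A \<in> X \<and> B \<in> X))"

definition left_approx :: "'o set \<Rightarrow> 'o \<Rightarrow> 'o \<Rightarrow> 'm \<Rightarrow> bool" where
  "left_approx X A Y f \<longleftrightarrow> Y \<in> X \<and> f \<in> Hom A Y \<and>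
     (\<forall>Y'\<in>X. \<forall>u\<in>Hom A Y'. \<exists>v\<in>Hom Y Y'. u = v \<cdot> f)"

definition right_approx :: "'o set \<Rightarrow> 'o \<Rightarrow> 'o \<Rightarrow> 'm \<Rightarrow> bool" where
  "right_approx X A Y f \<longleftrightarrow> Y \<in> X \<and> f \<in> Hom Y A \<and>
     (\<forall>Y'\<in>X. \<forall>u\<in>Hom Y' A. \<exists>v\<in>Hom Y' Y. u = f \<cdot> v)"

definition functorially_finite :: "'o set \<Rightarrow> bool" where
  "functorially_finite X \<longleftrightarrow>
     (\<forall>A\<in>Obj. (\<exists>Y f. left_approx X A Y f) \<and> (\<exists>Y f. right_approx X A Y f))"

definition X_monic :: "'o set \<Rightarrow> 'o \<Rightarrow> 'o \<Rightarrow> 'm \<Rightarrow> bool" where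
  "X_monic X A B f \<longleftrightarrow> f \<in> Hom A B \<and> (\<forall>Y\<in>X. (\<lambda>v. v \<cdot> f) ` Hom B Y = Hom A Y)"

(* A sequence A -x-> B -y-> D with fixed ends A and D is encoded as the triple (B, x, y). *)

definition seq_equiv :: "'o \<Rightarrow> 'o \<Rightarrow> 'o \<times> 'm \<times> 'm \<Rightarrow> 'o \<times> 'm \<times> 'm \<Rightarrow> bool" where
  "seq_equiv A D s s' \<longleftrightarrow> (case (s, s') of ((B, x, y), (B', x', y')) \<Rightarrow>
     B \<in> Obj \<and> B' \<in> Obj \<and> x \<in> Hom A B \<and> y \<in> Hom B D \<and> x' \<in> Hom A B' \<and> y' \<in> Hom B' D \<and>
     (\<exists>b. iso_mor B B' b \<and> b \<cdot> x = x' \<and> y' \<cdot> b = y))"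

definition seq_class :: "'o \<Rightarrow> 'o \<Rightarrow> 'o \<times> 'm \<times> 'm \<Rightarrow> ('o \<times> 'm \<times> 'm) set" where
  "seq_class A D s = {s'. seq_equiv A D s s'}"

(* f \<oplus> f' : S \<rightarrow> S', where S has projections p, q and S' has injections i', j' *)
abbreviation sum_mor :: "'o \<Rightarrow> 'o \<Rightarrow> 'm \<Rightarrow> 'm \<Rightarrow> 'm \<Rightarrow> 'm \<Rightarrow> 'm \<Rightarrow> 'm \<Rightarrow> 'm" where
  "sum_mor S S' i' j' p q f f' \<equiv> (i' \<cdot> f \<cdot> p) \<oplus>\<^bsub>Mor C S S'\<^esub> (j' \<cdot> f' \<cdot> q)"

end

locale preadditive_category = cat_data C for C :: "('k, 'o, 'm) lincat" +
  assumes hom_disjoint: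
    "\<lbrakk>A \<in> Obj; B \<in> Obj; A' \<in> Obj; B' \<in> Obj; f \<in> Hom A B; f \<in> Hom A' B'\<rbrakk>
       \<Longrightarrow> A = A' \<and> B = B'"
  and id_closed: "A \<in> Obj \<Longrightarrow> idn A \<in> Hom A A"
  and comp_closed:
    "\<lbrakk>A \<in> Obj; B \<in> Obj; D \<in> Obj; f \<in> Hom A B; g \<in> Hom B D\<rbrakk> \<Longrightarrow> g \<cdot> f \<in> Hom A D"
  and comp_id: "\<lbrakk>A \<in> Obj; B \<in> Obj; f \<in> Hom A B\<rbrakk> \<Longrightarrow> f \<cdot> idn A = f"
  and id_comp: "\<lbrakk>A \<in> Obj; B \<in> Obj; f \<in> Hom A B\<rbrakk> \<Longrightarrow> idn B \<cdot> f = f"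
  and comp_assoc:
    "\<lbrakk>A \<in> Obj; B \<in> Obj; D \<in> Obj; F \<in> Obj; f \<in> Hom A B; g \<in> Hom B D; h \<in> Hom D F\<rbrakk>
       \<Longrightarrow> (h \<cdot> g) \<cdot> f = h \<cdot> (g \<cdot> f)"
  and hom_abelian_group: "\<lbrakk>A \<in> Obj; B \<in> Obj\<rbrakk> \<Longrightarrow> abelian_group (Mor C A B)"
  and comp_add_left:
    "\<lbrakk>A \<in> Obj; B \<in> Obj; D \<in> Obj; f \<in> Hom A B; g \<in> Hom B D; g' \<in> Hom B D\<rbrakk>
       \<Longrightarrow> (g \<oplus>\<^bsub>Mor C B D\<^esub> g') \<cdot> f = (g \<cdot> f) \<oplus>\<^bsub>Mor C A D\<^esub> (g' \<cdot> f)"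
  and comp_add_right:
    "\<lbrakk>A \<in> Obj; B \<in> Obj; D \<in> Obj; f \<in> Hom A B; f' \<in> Hom A B; g \<in> Hom B D\<rbrakk>
       \<Longrightarrow> g \<cdot> (f \<oplus>\<^bsub>Mor C A B\<^esub> f') = (g \<cdot> f) \<oplus>\<^bsub>Mor C A D\<^esub> (g \<cdot> f')"

locale additive_category = preadditive_category C for C :: "('k, 'o, 'm) lincat" +
  assumes has_zero_object: "\<exists>Z. zero_object Z"
  and has_biproducts: "\<lbrakk>A \<in> Obj; B \<in> Obj\<rbrakk> \<Longrightarrow> \<exists>S i j p q. biproduct A B S i j p q"

locale linear_krull_schmidt_category = additive_category C + field K
  for K :: "('k, 'z) ring_scheme" and C :: "('k, 'o, 'm) lincat" +
  assumes hom_module: "\<lbrakk>A \<in> Obj; B \<in> Obj\<rbrakk> \<Longrightarrow> module K (Mor C A B)"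
  and comp_smult:
    "\<lbrakk>A \<in> Obj; B \<in> Obj; D \<in> Obj; r \<in> carrier K; f \<in> Hom A B; g \<in> Hom B D\<rbrakk>
       \<Longrightarrow> (r \<odot>\<^bsub>Mor C B D\<^esub> g) \<cdot> f = r \<odot>\<^bsub>Mor C A D\<^esub> (g \<cdot> f) \<and>
           g \<cdot> (r \<odot>\<^bsub>Mor C A B\<^esub> f) = r \<odot>\<^bsub>Mor C A D\<^esub> (g \<cdot> f)"
  and krull_schmidt: "A \<in> Obj \<Longrightarrow> \<exists>As. direct_sum As A \<and> (\<forall>B\<in>set As. local_End B)"

(* An additive autoequivalence T (not necessarily an automorphism): To on objects, Tm on
   morphisms. *)

locale additive_autoequivalence = additive_category C
  for C :: "('k, 'o, 'm) lincat" and To :: "'o \<Rightarrow> 'o" and Tm :: "'m \<Rightarrow> 'm" +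
  assumes T_obj: "A \<in> Obj \<Longrightarrow> To A \<in> Obj"
  and T_id: "A \<in> Obj \<Longrightarrow> Tm (idn A) = idn (To A)"
  and T_comp: "\<lbrakk>A \<in> Obj; B \<in> Obj; D \<in> Obj; f \<in> Hom A B; g \<in> Hom B D\<rbrakk>
       \<Longrightarrow> Tm (g \<cdot> f) = Tm g \<cdot> Tm f"
  and T_add: "\<lbrakk>A \<in> Obj; B \<in> Obj; f \<in> Hom A B; g \<in> Hom A B\<rbrakk>
       \<Longrightarrow> Tm (f \<oplus>\<^bsub>Mor C A B\<^esub> g) = Tm f \<oplus>\<^bsub>Mor C (To A) (To B)\<^esub> Tm g"
  and T_fully_faithful:
    "\<lbrakk>A \<in> Obj; B \<in> Obj\<rbrakk> \<Longrightarrow> bij_betw Tm (Hom A B) (Hom (To A) (To B))"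
  and T_ess_surj: "B \<in> Obj \<Longrightarrow> \<exists>A\<in>Obj. \<exists>f. iso_mor (To A) B f"

(* tri A B D f g h: the sequence A -f-> B -g-> D -h-> To A is a distinguished triangle *)

locale triangle_data = cat_data C
  for C :: "('k, 'o, 'm) lincat" and To :: "'o \<Rightarrow> 'o" and Tm :: "'m \<Rightarrow> 'm"
  and tri :: "'o \<Rightarrow> 'o \<Rightarrow> 'o \<Rightarrow> 'm \<Rightarrow> 'm \<Rightarrow> 'm \<Rightarrow> bool"
begin

definition ar_triangle :: "'o \<Rightarrow> 'o \<Rightarrow> 'o \<Rightarrow> 'm \<Rightarrow> 'm \<Rightarrow> 'm \<Rightarrow> bool" where
  "ar_triangle A B D f g h \<longleftrightarrow> tri A B D f g h \<and> source_mor A B f \<and> sink_mor B D g"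

definition has_AR_translation :: bool where
  "has_AR_translation \<longleftrightarrow> (\<forall>A. indecomposable A \<longrightarrow>
     (\<exists>B D f g h. ar_triangle D B A f g h) \<and> (\<exists>B D f g h. ar_triangle A B D f g h))"

(* AR_translate A D: A is (isomorphic to) \<tau> D, where \<tau> is extended additively from the
   indecomposable objects; AR translates are determined up to isomorphism only *)
definition AR_translate :: "'o \<Rightarrow> 'o \<Rightarrow> bool" where
  "AR_translate A D \<longleftrightarrow> (\<exists>As Ds. direct_sum As A \<and> direct_sum Ds D \<and>
     list_all2 (\<lambda>A' D'. \<exists>B f g h. ar_triangle A' B D' f g h) As Ds)"

definition tau_image :: "'o set \<Rightarrow> 'o set" where
  "tau_image X = {A. \<exists>D\<in>X. AR_translate A D}"

end

locale triangulated_category =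
  triangle_data C To Tm tri + additive_autoequivalence C To Tm
  for C :: "('k, 'o, 'm) lincat" and To :: "'o \<Rightarrow> 'o" and Tm :: "'m \<Rightarrow> 'm"
  and tri :: "'o \<Rightarrow> 'o \<Rightarrow> 'o \<Rightarrow> 'm \<Rightarrow> 'm \<Rightarrow> 'm \<Rightarrow> bool" +
  assumes tri_typed: "tri A B D f g h \<Longrightarrow> A \<in> Obj \<and> B \<in> Obj \<and> D \<in> Obj \<and>
       f \<in> Hom A B \<and> g \<in> Hom B D \<and> h \<in> Hom D (To A)"
  and TR1_iso:
    "\<lbrakk>tri A B D f g h; A' \<in> Obj; B' \<in> Obj; D' \<in> Obj;
      f' \<in> Hom A' B'; g' \<in> Hom B' D'; h' \<in> Hom D' (To A');
      iso_mor A A' a; iso_mor B B' b; iso_mor D D' d;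
      b \<cdot> f = f' \<cdot> a; d \<cdot> g = g' \<cdot> b; Tm a \<cdot> h = h' \<cdot> d\<rbrakk> \<Longrightarrow> tri A' B' D' f' g' h'"
  and TR1_id:
    "\<lbrakk>A \<in> Obj; zero_object Z\<rbrakk> \<Longrightarrow> tri A A Z (idn A) (nul A Z) (nul Z (To A))"
  and TR1_cone:
    "\<lbrakk>A \<in> Obj; B \<in> Obj; f \<in> Hom A B\<rbrakk> \<Longrightarrow> \<exists>D g h. tri A B D f g h"
  and TR2:
    "\<lbrakk>A \<in> Obj; B \<in> Obj; D \<in> Obj; f \<in> Hom A B; g \<in> Hom B D; h \<in> Hom D (To A)\<rbrakk>
       \<Longrightarrow> tri A B D f g h \<longleftrightarrow> tri B D (To A) g h (\<ominus>\<^bsub>Mor C (To A) (To B)\<^esub> Tm f)"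
  and TR3:
    "\<lbrakk>tri A B D f g h; tri A' B' D' f' g' h'; a \<in> Hom A A'; b \<in> Hom B B'; b \<cdot> f = f' \<cdot> a\<rbrakk>
       \<Longrightarrow> \<exists>d\<in>Hom D D'. d \<cdot> g = g' \<cdot> b \<and> Tm a \<cdot> h = h' \<cdot> d"
  and TR4:
    "\<lbrakk>tri A B D f f1 f2; tri B E F g g1 g2; tri A E G (g \<cdot> f) h1 h2\<rbrakk>
       \<Longrightarrow> \<exists>u\<in>Hom D G. \<exists>v\<in>Hom G F. tri D G F u v (Tm f1 \<cdot> g2) \<and>
            u \<cdot> f1 = h1 \<cdot> g \<and> v \<cdot> h1 = g1 \<and> h2 \<cdot> u = f2 \<and> g2 \<cdot> v = Tm f \<cdot> h2"

(* Extension groups are monoid records in the sense of HOL-Algebra: their addition is written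
   as multiplication and their zero as the unit.
     carrier (Ext E D A) = E(D, A)
     push E D a          = E(D, a), the map d |-> a_* d
     pull E c A          = E(c, A), the map d |-> c^* d
     rlz E D A d         = s(d), an equivalence class of sequences from A to D *)

record ('o, 'm, 'e) extri =
  Ext  :: "'o \<Rightarrow> 'o \<Rightarrow> 'e monoid"
  push :: "'o \<Rightarrow> 'm \<Rightarrow> 'e \<Rightarrow> 'e"
  pull :: "'m \<Rightarrow> 'o \<Rightarrow> 'e \<Rightarrow> 'e"
  rlz  :: "'o \<Rightarrow> 'o \<Rightarrow> 'e \<Rightarrow> ('o \<times> 'm \<times> 'm) set"

locale extri_data = cat_data C
  for C :: "('k, 'o, 'm) lincat" and E :: "('o, 'm, 'e) extri"
begin

abbreviation "Exts D A \<equiv> carrier (Ext E D A)"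

definition E_triangle :: "'o \<Rightarrow> 'o \<Rightarrow> 'o \<Rightarrow> 'm \<Rightarrow> 'm \<Rightarrow> 'e \<Rightarrow> bool" where
  "E_triangle A B D x y \<delta> \<longleftrightarrow>
     A \<in> Obj \<and> D \<in> Obj \<and> \<delta> \<in> Exts D A \<and> (B, x, y) \<in> rlz E D A \<delta>"

definition projective :: "'o \<Rightarrow> bool" where
  "projective P \<longleftrightarrow> P \<in> Obj \<and>
     (\<forall>A B D x y \<delta>. E_triangle A B D x y \<delta> \<longrightarrow> (\<forall>u\<in>Hom P D. \<exists>v\<in>Hom P B. u = y \<cdot> v))"

definition injective :: "'o \<Rightarrow> bool" where
  "injective I \<longleftrightarrow> I \<in> Obj \<and>
     (\<forall>A B D x y \<delta>. E_triangle A B D x y \<delta> \<longrightarrow> (\<forall>u\<in>Hom A I. \<exists>v\<in>Hom B I. u = v \<cdot> x))"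

definition frobenius :: bool where
  "frobenius \<longleftrightarrow>
     (\<forall>D\<in>Obj. (\<exists>A P x y \<delta>. projective P \<and> E_triangle A P D x y \<delta>) \<and>
              (\<exists>I F x y \<delta>. injective I \<and> E_triangle D I F x y \<delta>)) \<and>
     (\<forall>P. projective P \<longleftrightarrow> injective P)"

(* \<delta> \<oplus> \<delta>' in E(SD, SA), where SA has injections iA, jA and SD has projections pD, qD *)
abbreviation sum_ext where
  "sum_ext A A' SA iA jA SD pD qD \<delta> \<delta>' \<equiv>
     push E SD iA (pull E pD A \<delta>) \<otimes>\<^bsub>Ext E SD SA\<^esub> push E SD jA (pull E qD A' \<delta>')"

end

locale extriangulated_category = extri_data C E + additive_category C
  for C :: "('k, 'o, 'm) lincat" and E :: "('o, 'm, 'e) extri" +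
  assumes ET1_group: "\<lbrakk>D \<in> Obj; A \<in> Obj\<rbrakk> \<Longrightarrow> comm_group (Ext E D A)"
  and ET1_push_hom: "\<lbrakk>D \<in> Obj; A \<in> Obj; A' \<in> Obj; a \<in> Hom A A'\<rbrakk>
       \<Longrightarrow> push E D a \<in> hom (Ext E D A) (Ext E D A')"
  and ET1_pull_hom: "\<lbrakk>D \<in> Obj; D' \<in> Obj; A \<in> Obj; c \<in> Hom D' D\<rbrakk>
       \<Longrightarrow> pull E c A \<in> hom (Ext E D A) (Ext E D' A)"
  and ET1_push_id: "\<lbrakk>D \<in> Obj; A \<in> Obj; \<delta> \<in> Exts D A\<rbrakk> \<Longrightarrow> push E D (idn A) \<delta> = \<delta>"
  and ET1_pull_id: "\<lbrakk>D \<in> Obj; A \<in> Obj; \<delta> \<in> Exts D A\<rbrakk> \<Longrightarrow> pull E (idn D) A \<delta> = \<delta>"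
  and ET1_push_comp: "\<lbrakk>D \<in> Obj; A \<in> Obj; A' \<in> Obj; A'' \<in> Obj;
       a \<in> Hom A A'; a' \<in> Hom A' A''; \<delta> \<in> Exts D A\<rbrakk>
       \<Longrightarrow> push E D (a' \<cdot> a) \<delta> = push E D a' (push E D a \<delta>)"
  and ET1_pull_comp: "\<lbrakk>D \<in> Obj; D' \<in> Obj; D'' \<in> Obj; A \<in> Obj;
       c \<in> Hom D' D; c' \<in> Hom D'' D'; \<delta> \<in> Exts D A\<rbrakk>
       \<Longrightarrow> pull E (c \<cdot> c') A \<delta> = pull E c' A (pull E c A \<delta>)"
  and ET1_push_pull: "\<lbrakk>D \<in> Obj; D' \<in> Obj; A \<in> Obj; A' \<in> Obj;
       a \<in> Hom A A'; c \<in> Hom D' D; \<delta> \<in> Exts D A\<rbrakk>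
       \<Longrightarrow> push E D' a (pull E c A \<delta>) = pull E c A' (push E D a \<delta>)"
  and ET1_push_add: "\<lbrakk>D \<in> Obj; A \<in> Obj; A' \<in> Obj;
       a \<in> Hom A A'; a' \<in> Hom A A'; \<delta> \<in> Exts D A\<rbrakk>
       \<Longrightarrow> push E D (a \<oplus>\<^bsub>Mor C A A'\<^esub> a') \<delta>
          = push E D a \<delta> \<otimes>\<^bsub>Ext E D A'\<^esub> push E D a' \<delta>"
  and ET1_pull_add: "\<lbrakk>D \<in> Obj; D' \<in> Obj; A \<in> Obj;
       c \<in> Hom D' D; c' \<in> Hom D' D; \<delta> \<in> Exts D A\<rbrakk>
       \<Longrightarrow> pull E (c \<oplus>\<^bsub>Mor C D' D\<^esub> c') A \<delta>
          = pull E c A \<delta> \<otimes>\<^bsub>Ext E D' A\<^esub> pull E c' A \<delta>"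
  and ET2_class: "\<lbrakk>D \<in> Obj; A \<in> Obj; \<delta> \<in> Exts D A\<rbrakk>
       \<Longrightarrow> \<exists>B\<in>Obj. \<exists>x\<in>Hom A B. \<exists>y\<in>Hom B D. rlz E D A \<delta> = seq_class A D (B, x, y)"
  and ET2_morphism: "\<lbrakk>E_triangle A B D x y \<delta>; E_triangle A' B' D' x' y' \<delta>';
       a \<in> Hom A A'; c \<in> Hom D D'; push E D a \<delta> = pull E c A' \<delta>'\<rbrakk>
       \<Longrightarrow> \<exists>b\<in>Hom B B'. b \<cdot> x = x' \<cdot> a \<and> y' \<cdot> b = c \<cdot> y"
  and ET2_zero: "biproduct A D S i j p q
       \<Longrightarrow> rlz E D A \<one>\<^bsub>Ext E D A\<^esub> = seq_class A D (S, i, q)"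
  and ET2_sum: "\<lbrakk>E_triangle A B D x y \<delta>; E_triangle A' B' D' x' y' \<delta>';
       biproduct A A' SA iA jA pA qA; biproduct B B' SB iB jB pB qB;
       biproduct D D' SD iD jD pD qD\<rbrakk>
       \<Longrightarrow> rlz E SD SA (sum_ext A A' SA iA jA SD pD qD \<delta> \<delta>')
          = seq_class SA SD (SB, sum_mor SA SB iB jB pA qA x x', sum_mor SB SD iD jD pB qB y y')"
  and ET3: "\<lbrakk>E_triangle A B D x y \<delta>; E_triangle A' B' D' x' y' \<delta>';
       a \<in> Hom A A'; b \<in> Hom B B'; b \<cdot> x = x' \<cdot> a\<rbrakk>
       \<Longrightarrow> \<exists>c\<in>Hom D D'. push E D a \<delta> = pull E c A' \<delta>' \<and> c \<cdot> y = y' \<cdot> b"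
  and ET3_op: "\<lbrakk>E_triangle A B D x y \<delta>; E_triangle A' B' D' x' y' \<delta>';
       b \<in> Hom B B'; c \<in> Hom D D'; c \<cdot> y = y' \<cdot> b\<rbrakk>
       \<Longrightarrow> \<exists>a\<in>Hom A A'. push E D a \<delta> = pull E c A' \<delta>' \<and> b \<cdot> x = x' \<cdot> a"
  and ET4: "\<lbrakk>E_triangle A B D f f' \<delta>; E_triangle B G F g g' \<delta>'\<rbrakk>
       \<Longrightarrow> \<exists>H\<in>Obj. \<exists>h'\<in>Hom G H. \<exists>d\<in>Hom D H. \<exists>e\<in>Hom H F. \<exists>\<delta>''.
            h' \<cdot> g = d \<cdot> f' \<and> e \<cdot> h' = g' \<and>
            E_triangle A G H (g \<cdot> f) h' \<delta>'' \<and> E_triangle D H F d e (push E F f' \<delta>') \<and>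
            pull E d A \<delta>'' = \<delta> \<and> push E H f \<delta>'' = pull E e B \<delta>'"
  and ET4_op: "\<lbrakk>E_triangle D A B f' f \<delta>; E_triangle F B G g' g \<delta>'\<rbrakk>
       \<Longrightarrow> \<exists>H\<in>Obj. \<exists>d\<in>Hom D H. \<exists>e\<in>Hom H F. \<exists>h'\<in>Hom H A. \<exists>\<delta>''.
            h' \<cdot> d = f' \<and> f \<cdot> h' = g' \<cdot> e \<and>
            E_triangle H A G h' (g \<cdot> f) \<delta>'' \<and> E_triangle D H F d e (pull E g' D \<delta>) \<and>
            push E G e \<delta>'' = \<delta>' \<and> push E B d \<delta> = pull E g H \<delta>''"

(* The additive groups Hom(D, T A) *)
definition shifted_hom_group ::
    "('k, 'o, 'm) lincat \<Rightarrow> ('o \<Rightarrow> 'o) \<Rightarrow> 'o \<Rightarrow> 'o \<Rightarrow> 'm monoid" where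
  "shifted_hom_group C To D A =
     \<lparr>carrier = carrier (Mor C D (To A)), mult = add (Mor C D (To A)),
      one = zero (Mor C D (To A))\<rparr>"

context extri_data
begin

definition is_triangulated :: bool where
  "is_triangulated \<longleftrightarrow> (\<exists>To Tm tri \<phi>. triangulated_category C To Tm tri \<and>
     (\<forall>D\<in>Obj. \<forall>A\<in>Obj. \<phi> D A \<in> iso (Ext E D A) (shifted_hom_group C To D A)) \<and>
     (\<forall>D\<in>Obj. \<forall>A\<in>Obj. \<forall>A'\<in>Obj. \<forall>a\<in>Hom A A'. \<forall>\<delta>\<in>Exts D A.
        \<phi> D A' (push E D a \<delta>) = Tm a \<cdot> \<phi> D A \<delta>) \<and>
     (\<forall>D\<in>Obj. \<forall>D'\<in>Obj. \<forall>A\<in>Obj. \<forall>c\<in>Hom D' D. \<forall>\<delta>\<in>Exts D A.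
        \<phi> D' A (pull E c A \<delta>) = \<phi> D A \<delta> \<cdot> c) \<and>
     (\<forall>A\<in>Obj. \<forall>D\<in>Obj. \<forall>\<delta>\<in>Exts D A. \<forall>B x y.
        tri A B D x y (\<phi> D A \<delta>) \<longrightarrow> rlz E D A \<delta> = seq_class A D (B, x, y)))"

end

context cat_data
begin

definition kernel_cokernel_pair :: "'o \<Rightarrow> 'o \<Rightarrow> 'o \<Rightarrow> 'm \<Rightarrow> 'm \<Rightarrow> bool" where
  "kernel_cokernel_pair A B D x y \<longleftrightarrow>
     A \<in> Obj \<and> B \<in> Obj \<and> D \<in> Obj \<and> x \<in> Hom A B \<and> y \<in> Hom B D \<and> y \<cdot> x = nul A D \<and>
     (\<forall>W\<in>Obj. \<forall>u\<in>Hom W B. y \<cdot> u = nul W D \<longrightarrow> (\<exists>!v. v \<in> Hom W A \<and> x \<cdot> v = u)) \<and>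
     (\<forall>W\<in>Obj. \<forall>u\<in>Hom B W. u \<cdot> x = nul A W \<longrightarrow> (\<exists>!v. v \<in> Hom D W \<and> v \<cdot> y = u))"

(* the square with x : A \<rightarrow> B, a : A \<rightarrow> A', b : B \<rightarrow> P, x' : A' \<rightarrow> P is a push-out *)
definition pushout :: "'o \<Rightarrow> 'o \<Rightarrow> 'o \<Rightarrow> 'o \<Rightarrow> 'm \<Rightarrow> 'm \<Rightarrow> 'm \<Rightarrow> 'm \<Rightarrow> bool" where
  "pushout A B A' P x a b x' \<longleftrightarrow>
     P \<in> Obj \<and> b \<in> Hom B P \<and> x' \<in> Hom A' P \<and> b \<cdot> x = x' \<cdot> a \<and>
     (\<forall>W\<in>Obj. \<forall>u\<in>Hom B W. \<forall>u'\<in>Hom A' W. u \<cdot> x = u' \<cdot> a \<longrightarrow>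
        (\<exists>!v. v \<in> Hom P W \<and> v \<cdot> b = u \<and> v \<cdot> x' = u'))"

(* the square with b : P \<rightarrow> B, y' : P \<rightarrow> D', y : B \<rightarrow> D, c : D' \<rightarrow> D is a pull-back *)
definition pullback :: "'o \<Rightarrow> 'o \<Rightarrow> 'o \<Rightarrow> 'o \<Rightarrow> 'm \<Rightarrow> 'm \<Rightarrow> 'm \<Rightarrow> 'm \<Rightarrow> bool" where
  "pullback B D D' P y c b y' \<longleftrightarrow>
     P \<in> Obj \<and> b \<in> Hom P B \<and> y' \<in> Hom P D' \<and> y \<cdot> b = c \<cdot> y' \<and>
     (\<forall>W\<in>Obj. \<forall>u\<in>Hom W B. \<forall>u'\<in>Hom W D'. y \<cdot> u = c \<cdot> u' \<longrightarrow>
        (\<exists>!v. v \<in> Hom W P \<and> b \<cdot> v = u \<and> y' \<cdot> v = u'))"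

end

(* ses A B D x y: the sequence A -x-> B -y-> D is an admissible short exact sequence *)

locale quillen_exact_category = additive_category C
  for C :: "('k, 'o, 'm) lincat" and ses :: "'o \<Rightarrow> 'o \<Rightarrow> 'o \<Rightarrow> 'm \<Rightarrow> 'm \<Rightarrow> bool" +
  assumes ses_ker_coker: "ses A B D x y \<Longrightarrow> kernel_cokernel_pair A B D x y"
  and ses_iso:
    "\<lbrakk>ses A B D x y; A' \<in> Obj; B' \<in> Obj; D' \<in> Obj; x' \<in> Hom A' B'; y' \<in> Hom B' D';
      iso_mor A A' a; iso_mor B B' b; iso_mor D D' d; b \<cdot> x = x' \<cdot> a; d \<cdot> y = y' \<cdot> b\<rbrakk>
       \<Longrightarrow> ses A' B' D' x' y'"
  and id_admissible_mono: "A \<in> Obj \<Longrightarrow> \<exists>D y. ses A A D (idn A) y"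
  and id_admissible_epi: "A \<in> Obj \<Longrightarrow> \<exists>B x. ses B A A x (idn A)"
  and comp_admissible_mono:
    "\<lbrakk>ses A B D x y; ses B B' D' x' y'\<rbrakk> \<Longrightarrow> \<exists>F z. ses A B' F (x' \<cdot> x) z"
  and comp_admissible_epi:
    "\<lbrakk>ses A B D x y; ses A' D D' x' y'\<rbrakk> \<Longrightarrow> \<exists>F z. ses F B D' z (y' \<cdot> y)"
  and pushout_admissible_mono:
    "\<lbrakk>ses A B D x y; A' \<in> Obj; a \<in> Hom A A'\<rbrakk>
       \<Longrightarrow> \<exists>P b x'. pushout A B A' P x a b x' \<and> (\<exists>D' y'. ses A' P D' x' y')"
  and pullback_admissible_epi:
    "\<lbrakk>ses A B D x y; D' \<in> Obj; c \<in> Hom D' D\<rbrakk>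
       \<Longrightarrow> \<exists>P b y'. pullback B D D' P y c b y' \<and> (\<exists>A' x'. ses A' P D' x' y')"

(* The bifunctor Ext^1 of an exact category: elements of Ext^1(D, A) are equivalence classes of
   admissible short exact sequences. The class a_* \<xi> consists of the sequences receiving a
   morphism (a, b, 1) from a member of \<xi>, since such a morphism exhibits its target as the
   push-out of its source along a; dually for c^* \<xi>. *)

locale yoneda_ext = cat_data C
  for C :: "('k, 'o, 'm) lincat" and ses :: "'o \<Rightarrow> 'o \<Rightarrow> 'o \<Rightarrow> 'm \<Rightarrow> 'm \<Rightarrow> bool"
begin

definition Ext1 :: "'o \<Rightarrow> 'o \<Rightarrow> ('o \<times> 'm \<times> 'm) set set" where
  "Ext1 D A = {seq_class A D (B, x, y) | B x y. ses A B D x y}"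

definition ext_push :: "'o \<Rightarrow> 'o \<Rightarrow> 'm \<Rightarrow> ('o \<times> 'm \<times> 'm) set \<Rightarrow> ('o \<times> 'm \<times> 'm) set" where
  "ext_push D A' a \<xi> = {(B', x', y'). ses A' B' D x' y' \<and>
     (\<exists>(B, x, y)\<in>\<xi>. \<exists>b\<in>Hom B B'. b \<cdot> x = x' \<cdot> a \<and> y' \<cdot> b = y)}"

definition ext_pull :: "'o \<Rightarrow> 'o \<Rightarrow> 'm \<Rightarrow> ('o \<times> 'm \<times> 'm) set \<Rightarrow> ('o \<times> 'm \<times> 'm) set" where
  "ext_pull D' A c \<xi> = {(B', x', y'). ses A B' D' x' y' \<and>
     (\<exists>(B, x, y)\<in>\<xi>. \<exists>b\<in>Hom B' B. b \<cdot> x' = x \<and> y \<cdot> b = c \<cdot> y')}"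

(* Baer sum: push-out along the codiagonal of A of the pull-back along the diagonal of D of
   the direct sum of the two sequences *)
definition baer_sum ::
    "'o \<Rightarrow> 'o \<Rightarrow> ('o \<times> 'm \<times> 'm) set \<Rightarrow> ('o \<times> 'm \<times> 'm) set \<Rightarrow> ('o \<times> 'm \<times> 'm) set" where
  "baer_sum D A \<xi> \<xi>' = {s.
     \<exists>B x y B' x' y' SA iA jA pA qA SB iB jB pB qB SD iD jD pD qD.
       (B, x, y) \<in> \<xi> \<and> (B', x', y') \<in> \<xi>' \<and>
       biproduct A A SA iA jA pA qA \<and> biproduct B B' SB iB jB pB qB \<and>
       biproduct D D SD iD jD pD qD \<and>
       s \<in> ext_push D A (pA \<oplus>\<^bsub>Mor C SA A\<^esub> qA)
             (ext_pull D SA (iD \<oplus>\<^bsub>Mor C D SD\<^esub> jD)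
               (seq_class SA SD
                 (SB, sum_mor SA SB iB jB pA qA x x', sum_mor SB SD iD jD pB qB y y')))}"

end

context extri_data
begin

(* The identification of E with Ext^1 is necessarily the realization itself. *)
definition is_exact :: bool where
  "is_exact \<longleftrightarrow> (\<exists>ses. quillen_exact_category C ses \<and>
     (\<forall>D\<in>Obj. \<forall>A\<in>Obj. bij_betw (rlz E D A) (Exts D A) (yoneda_ext.Ext1 C ses D A)) \<and>
     (\<forall>D\<in>Obj. \<forall>A\<in>Obj. \<forall>\<delta>\<in>Exts D A. \<forall>\<delta>'\<in>Exts D A.
        rlz E D A (\<delta> \<otimes>\<^bsub>Ext E D A\<^esub> \<delta>')
          = yoneda_ext.baer_sum C ses D A (rlz E D A \<delta>) (rlz E D A \<delta>')) \<and>
     (\<forall>D\<in>Obj. \<forall>A\<in>Obj. \<forall>A'\<in>Obj. \<forall>a\<in>Hom A A'. \<forall>\<delta>\<in>Exts D A.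
        rlz E D A' (push E D a \<delta>) = yoneda_ext.ext_push C ses D A' a (rlz E D A \<delta>)) \<and>
     (\<forall>D\<in>Obj. \<forall>D'\<in>Obj. \<forall>A\<in>Obj. \<forall>c\<in>Hom D' D. \<forall>\<delta>\<in>Exts D A.
        rlz E D' A (pull E c A \<delta>) = yoneda_ext.ext_pull C ses D' A c (rlz E D A \<delta>)))"

end

context triangle_data
begin

definition relative_extri :: "'o set \<Rightarrow> ('o, 'm, 'm) extri" where
  "relative_extri X =
     \<lparr>Ext = (\<lambda>D A. (shifted_hom_group C To D A)
        \<lparr>carrier := {\<delta> \<in> Hom D (To A). \<exists>B f g. tri A B D f g \<delta> \<and> X_monic X A B f}\<rparr>),
      push = (\<lambda>D a \<delta>. Tm a \<cdot> \<delta>),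
      pull = (\<lambda>c A \<delta>. \<delta> \<cdot> c),
      rlz = (\<lambda>D A \<delta>. \<Union>{seq_class A D (B, f, g) | B f g. tri A B D f g \<delta>})\<rparr>"

end

end

theory Submission
  imports Defs
begin

text \<open>For a triangle \<open>A \<rightarrow> B \<rightarrow> D \<rightarrow> T A\<close> with connecting morphism \<open>\<delta>\<close>, the first map is
  \<open>X\<close>-monic if and only if \<open>\<delta>\<close> is killed by all \<open>T u\<close> with \<open>u\<close> from \<open>A\<close> to \<open>X\<close>, and the second
  map is \<open>X\<close>-epic if and only if \<open>\<delta>\<close> kills all morphisms from \<open>X\<close> to \<open>D\<close>. By
  Auslander--Reiten theory the two conditions agree when \<open>\<tau> X = X\<close>. Hence \<open>E'\<close> is a
  sub-bifunctor of \<open>Hom(-, T -)\<close>, and the extriangulated axioms follow from those of the triangulated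
  structure: the closure of inflations under composition uses the description by \<open>X\<close>-monic maps and that
  of deflations the description by \<open>X\<close>-epic maps. Approximations of an object complete to triangles in
  \<open>E'\<close>, so \<open>X\<close> consists of the projectives and of the injectives. A nonzero injective object
  \<open>P\<close> excludes the triangle \<open>P \<rightarrow> 0 \<rightarrow> T P\<close>, and an object \<open>D\<close> outside \<open>X\<close> admits a non-split
  \<open>E'\<close>-triangle \<open>A \<rightarrow> Y \<rightarrow> D\<close>, whose deflation is not epic.\<close>

section \<open>Preadditive categories\<close>

context preadditive_category
begin

text \<open>Since the hom-sets are disjoint, a morphism determines its source and target; the untyped
  addition and negation then allow conditional rewriting with ground side conditions.\<close>

definition arr :: "'m \<Rightarrow> bool" where
  "arr f \<longleftrightarrow> (\<exists>A\<in>Obj. \<exists>B\<in>Obj. f \<in> Hom A B)"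

definition src :: "'m \<Rightarrow> 'o" where
  "src f = (THE A. A \<in> Obj \<and> (\<exists>B\<in>Obj. f \<in> Hom A B))"

definition tgt :: "'m \<Rightarrow> 'o" where
  "tgt f = (THE B. B \<in> Obj \<and> (\<exists>A\<in>Obj. f \<in> Hom A B))"

definition plus :: "'m \<Rightarrow> 'm \<Rightarrow> 'm" (infixl "\<boxplus>" 65) where
  "f \<boxplus> g = f \<oplus>\<^bsub>Mor C (src f) (tgt f)\<^esub> g"

definition neg :: "'m \<Rightarrow> 'm" where
  "neg f = \<ominus>\<^bsub>Mor C (src f) (tgt f)\<^esub> f"

text \<open>\<open>hom_disjoint\<close> makes both descriptions in \<open>src\<close> and
  \<open>tgt\<close> unique. As a simp rule this turns membership in a hom-set into equations on
  sources and targets, which later side conditions are discharged by.\<close>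

lemma hom_iff [simp]:
  assumes "A \<in> Obj" "B \<in> Obj"
  shows "f \<in> Hom A B \<longleftrightarrow> arr f \<and> src f = A \<and> tgt f = B"
proof
  assume f: "f \<in> Hom A B"
  have "src f = A" unfolding src_def using assms f hom_disjoint by blast
  moreover have "tgt f = B" unfolding tgt_def using assms f hom_disjoint by blast
  ultimately show "arr f \<and> src f = A \<and> tgt f = B" using assms f arr_def by auto
next
  assume f: "arr f \<and> src f = A \<and> tgt f = B"
  then obtain A' B' where *: "A' \<in> Obj" "B' \<in> Obj" "f \<in> Hom A' B'" using arr_def by auto
  have "src f = A'" unfolding src_def using * hom_disjoint by blast
  moreover have "tgt f = B'" unfolding tgt_def using * hom_disjoint by blast
  ultimately show "f \<in> Hom A B" using * f by auto
qed

lemma arr_obj [simp]: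
  assumes "arr f"
  shows "src f \<in> Obj" "tgt f \<in> Obj"
  using assms hom_iff unfolding arr_def by auto

lemma arr_hom: "arr f \<Longrightarrow> f \<in> Hom (src f) (tgt f)"
  by simp

lemma idn_arr [simp]:
  assumes "A \<in> Obj"
  shows "arr (idn A)" "src (idn A) = A" "tgt (idn A) = A"
  using id_closed[OF assms] assms by auto

lemma comp_arr [simp]:
  assumes "arr f" "arr g" "tgt f = src g"
  shows "arr (g \<cdot> f)" "src (g \<cdot> f) = src f" "tgt (g \<cdot> f) = tgt g"
  using comp_closed[of "src f" "tgt f" "tgt g" f g] assms by auto

lemma comp_idn [simp]: "arr f \<Longrightarrow> src f = A \<Longrightarrow> f \<cdot> idn A = f"
  using comp_id[of "src f" "tgt f" f] by auto

lemma idn_comp [simp]: "arr f \<Longrightarrow> tgt f = A \<Longrightarrow> idn A \<cdot> f = f"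
  using id_comp[of "src f" "tgt f" f] by auto

lemma assoc [simp]:
  "arr f \<Longrightarrow> arr g \<Longrightarrow> arr h \<Longrightarrow> tgt f = src g \<Longrightarrow> tgt g = src h
     \<Longrightarrow> (h \<cdot> g) \<cdot> f = h \<cdot> (g \<cdot> f)"
  using comp_assoc[of "src f" "tgt f" "tgt g" "tgt h" f g h] by auto

lemma comp_eq_left:
  assumes "g \<cdot> f = k" "arr x" "arr f" "arr g" "tgt x = src f" "tgt f = src g"
  shows "g \<cdot> (f \<cdot> x) = k \<cdot> x"
  using assms assoc by metis

lemma nul_arr [simp]:
  assumes "A \<in> Obj" "B \<in> Obj"
  shows "arr (nul A B)" "src (nul A B) = A" "tgt (nul A B) = B"
proof -
  interpret abelian_group "Mor C A B" using hom_abelian_group assms .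
  show "arr (nul A B)" "src (nul A B) = A" "tgt (nul A B) = B"
    using zero_closed hom_iff[OF assms] by blast+
qed

lemma add_eq_plus [simp]:
  "arr f \<Longrightarrow> src f = A \<Longrightarrow> tgt f = B \<Longrightarrow> f \<oplus>\<^bsub>Mor C A B\<^esub> g = f \<boxplus> g"
  by (simp add: plus_def)

lemma a_inv_eq_neg [simp]:
  "arr f \<Longrightarrow> src f = A \<Longrightarrow> tgt f = B \<Longrightarrow> \<ominus>\<^bsub>Mor C A B\<^esub> f = neg f"
  by (simp add: neg_def)

lemma plus_arr [simp]:
  assumes "arr f" "arr g" "src f = src g" "tgt f = tgt g"
  shows "arr (f \<boxplus> g)" "src (f \<boxplus> g) = src g" "tgt (f \<boxplus> g) = tgt g"
proof -
  interpret abelian_group "Mor C (src f) (tgt f)" using hom_abelian_group assms by simp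
  have "f \<boxplus> g \<in> Hom (src f) (tgt f)"
    unfolding plus_def by (rule a_closed) (use assms in simp_all)
  then show "arr (f \<boxplus> g)" "src (f \<boxplus> g) = src g" "tgt (f \<boxplus> g) = tgt g"
    using assms by auto
qed

lemma neg_arr [simp]:
  assumes "arr f"
  shows "arr (neg f)" "src (neg f) = src f" "tgt (neg f) = tgt f"
proof -
  interpret abelian_group "Mor C (src f) (tgt f)" using hom_abelian_group assms by simp
  have "neg f \<in> Hom (src f) (tgt f)"
    unfolding neg_def by (rule a_inv_closed) (use assms in simp_all)
  then show "arr (neg f)" "src (neg f) = src f" "tgt (neg f) = tgt f"
    using assms by auto
qed

lemma plus_assoc:
  assumes "arr f" "arr g" "arr h" "src f = src g" "tgt f = tgt g" "src g = src h" "tgt g = tgt h"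
  shows "f \<boxplus> g \<boxplus> h = f \<boxplus> (g \<boxplus> h)"
proof -
  interpret abelian_group "Mor C (src f) (tgt f)" using hom_abelian_group assms by simp
  show ?thesis using a_assoc[of f g h] assms by simp
qed

lemma plus_comm:
  assumes "arr f" "arr g" "src f = src g" "tgt f = tgt g"
  shows "f \<boxplus> g = g \<boxplus> f"
proof -
  interpret abelian_group "Mor C (src f) (tgt f)" using hom_abelian_group assms by simp
  show ?thesis using a_comm[of f g] assms by simp
qed

lemma plus_nul [simp]:
  assumes "arr f" "src f = A" "tgt f = B"
  shows "f \<boxplus> nul A B = f" "nul A B \<boxplus> f = f"
proof -
  interpret abelian_group "Mor C (src f) (tgt f)" using hom_abelian_group arr_obj[OF assms(1)] .
  show "f \<boxplus> nul A B = f" "nul A B \<boxplus> f = f"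
    using r_zero[of f] l_zero[of f] assms by auto
qed

lemma plus_neg [simp]:
  assumes "arr f"
  shows "f \<boxplus> neg f = nul (src f) (tgt f)" "neg f \<boxplus> f = nul (src f) (tgt f)"
proof -
  interpret abelian_group "Mor C (src f) (tgt f)" using hom_abelian_group assms by simp
  show "f \<boxplus> neg f = nul (src f) (tgt f)" "neg f \<boxplus> f = nul (src f) (tgt f)"
    using r_neg[of f] l_neg[of f] assms by auto
qed

lemma neg_unique:
  assumes "arr f" "arr g" "src f = src g" "tgt f = tgt g" "f \<boxplus> g = nul (src f) (tgt f)"
  shows "g = neg f"
proof -
  interpret abelian_group "Mor C (src f) (tgt f)" using hom_abelian_group assms by simp
  show ?thesis using minus_equality[of g f] assms plus_comm[of f g] by simp
qed

lemma neg_neg [simp]: "arr f \<Longrightarrow> neg (neg f) = f"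
  using neg_unique[of "neg f" f] by simp

lemma neg_inject: "arr f \<Longrightarrow> arr g \<Longrightarrow> neg f = neg g \<longleftrightarrow> f = g"
  by (metis neg_neg)

lemma neg_nul [simp]: "A \<in> Obj \<Longrightarrow> B \<in> Obj \<Longrightarrow> neg (nul A B) = nul A B"
  using neg_unique[of "nul A B" "nul A B"] by simp

lemma plus_left_cancel:
  assumes "arr f" "arr g" "src f = src g" "tgt f = tgt g" "f \<boxplus> g = f"
  shows "g = nul (src f) (tgt f)"
proof -
  have "neg f \<boxplus> (f \<boxplus> g) = nul (src f) (tgt f)" using assms by simp
  then show ?thesis using plus_assoc[of "neg f" f g] assms by simp
qed

lemma plus_comp [simp]:
  assumes "arr f" "arr g" "arr g'" "src g = src g'" "tgt g = tgt g'" "tgt f = src g'"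
  shows "(g \<boxplus> g') \<cdot> f = (g \<cdot> f) \<boxplus> (g' \<cdot> f)"
  using comp_add_left[of "src f" "tgt f" "tgt g" f g g'] assms by simp

lemma comp_plus [simp]:
  assumes "arr f" "arr f'" "arr g" "src f = src f'" "tgt f = tgt f'" "tgt f' = src g"
  shows "g \<cdot> (f \<boxplus> f') = (g \<cdot> f) \<boxplus> (g \<cdot> f')"
  using comp_add_right[of "src f" "tgt f" "tgt g" f f' g] assms by simp

lemma nul_comp [simp]:
  assumes "arr f" "A \<in> Obj" "B \<in> Obj" "tgt f = A"
  shows "nul A B \<cdot> f = nul (src f) B"
proof -
  have "nul A B \<cdot> f \<boxplus> nul A B \<cdot> f = nul A B \<cdot> f"
    using plus_comp[of f "nul A B" "nul A B"] assms by simp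
  then show ?thesis using plus_left_cancel[of "nul A B \<cdot> f" "nul A B \<cdot> f"] assms by simp
qed

lemma comp_nul [simp]:
  assumes "arr g" "A \<in> Obj" "B \<in> Obj" "src g = B"
  shows "g \<cdot> nul A B = nul A (tgt g)"
proof -
  have "g \<cdot> nul A B \<boxplus> g \<cdot> nul A B = g \<cdot> nul A B"
    using comp_plus[of "nul A B" "nul A B" g] assms by simp
  then show ?thesis using plus_left_cancel[of "g \<cdot> nul A B" "g \<cdot> nul A B"] assms by simp
qed

lemma neg_comp [simp]:
  assumes "arr f" "arr g" "tgt f = src g"
  shows "neg g \<cdot> f = neg (g \<cdot> f)"
proof -
  have "g \<cdot> f \<boxplus> neg g \<cdot> f = nul (src f) (tgt g)"
    using plus_comp[of f g "neg g"] assms by simp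
  then show ?thesis using neg_unique[of "g \<cdot> f" "neg g \<cdot> f"] assms by simp
qed

lemma comp_neg [simp]:
  assumes "arr f" "arr g" "tgt f = src g"
  shows "g \<cdot> neg f = neg (g \<cdot> f)"
proof -
  have "g \<cdot> f \<boxplus> g \<cdot> neg f = nul (src f) (tgt g)"
    using comp_plus[of f "neg f" g] assms by simp
  then show ?thesis using neg_unique[of "g \<cdot> f" "g \<cdot> neg f"] assms by simp
qed

lemma zero_object_arr:
  assumes "zero_object Z" "arr f"
  shows "src f = Z \<Longrightarrow> f = nul Z (tgt f)" and "tgt f = Z \<Longrightarrow> f = nul (src f) Z"
proof -
  have Z: "Z \<in> Obj" "idn Z = nul Z Z" using assms zero_object_def by auto
  show "f = nul Z (tgt f)" if "src f = Z"
    using comp_idn[of f Z] comp_nul[of f Z Z] that assms Z by simp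
  show "f = nul (src f) Z" if "tgt f = Z"
    using idn_comp[of f Z] nul_comp[of f Z Z] that assms Z by simp
qed

section \<open>Isomorphisms\<close>

lemma iso_mor_arr:
  assumes "A \<in> Obj" "B \<in> Obj"
  shows "iso_mor A B f \<longleftrightarrow> arr f \<and> src f = A \<and> tgt f = B \<and>
    (\<exists>g. arr g \<and> src g = B \<and> tgt g = A \<and> g \<cdot> f = idn A \<and> f \<cdot> g = idn B)"
  using assms unfolding iso_mor_def by auto

lemma iso_idn: "A \<in> Obj \<Longrightarrow> iso_mor A A (idn A)"
  by (auto simp: iso_mor_arr intro!: exI[of _ "idn A"])

lemma iso_neg_idn: "A \<in> Obj \<Longrightarrow> iso_mor A A (neg (idn A))"
  by (auto simp: iso_mor_arr intro!: exI[of _ "neg (idn A)"])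

text \<open>\<open>f\<close> has a left inverse \<open>u \<cdot> g\<close> and a right inverse
  \<open>g \<cdot> v\<close>, and these must coincide.\<close>

lemma iso_cancel:
  assumes "arr f" "arr g" "src g = tgt f" "tgt g = src f"
    "iso_mor (src f) (src f) (g \<cdot> f)" "iso_mor (tgt f) (tgt f) (f \<cdot> g)"
  shows "iso_mor (src f) (tgt f) f"
proof -
  from assms obtain u where u: "arr u" "src u = src f" "tgt u = src f" "u \<cdot> (g \<cdot> f) = idn (src f)"
    by (auto simp: iso_mor_arr)
  from assms obtain v where v: "arr v" "src v = tgt f" "tgt v = tgt f" "f \<cdot> (g \<cdot> v) = idn (tgt f)"
    by (auto simp: iso_mor_arr)
  have "u \<cdot> g = u \<cdot> (g \<cdot> (f \<cdot> (g \<cdot> v)))" using assms(1-4) u(1-3) v by simp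
  also have "\<dots> = (u \<cdot> (g \<cdot> f)) \<cdot> (g \<cdot> v)" using assms u(1-3) v(1-3) by simp
  also have "\<dots> = g \<cdot> v" using assms u v by simp
  finally have *: "u \<cdot> g = g \<cdot> v" .
  have "f \<cdot> (u \<cdot> g) = idn (tgt f)" "u \<cdot> g \<cdot> f = idn (src f)" using u(4) v(4) unfolding * by simp_all
  then show ?thesis using assms(1-4) u(1-3)
    by (auto simp: iso_mor_arr intro!: exI[of _ "u \<cdot> g"])
qed

text \<open>The difference \<open>n\<close> of \<open>\<phi>\<close> and the identity factors through \<open>f\<close> and kills \<open>f\<close>, so \<open>n \<cdot> n = 0\<close>.\<close>

lemma iso_if_square_zero:
  assumes \<phi>: "arr \<phi>" "src \<phi> = B" "tgt \<phi> = B"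
    and v: "arr f" "arr v" "tgt f = B" "src v = B" "tgt v = src f"
    and n: "\<phi> \<boxplus> neg (idn B) = f \<cdot> v" and f: "\<phi> \<cdot> f = f"
  shows "iso_mor B B \<phi>"
proof -
  have B: "B \<in> Obj" using \<phi> by auto
  define n where "n = \<phi> \<boxplus> neg (idn B)"
  have narr: "arr n" "src n = B" "tgt n = B" unfolding n_def using \<phi> B by simp_all
  have "n \<cdot> f = nul (src f) B" unfolding n_def using \<phi> v B f by simp
  then have nn: "n \<cdot> n = nul B B"
    using comp_eq_left[of n f "nul (src f) B" v] narr v B by (simp add: n n_def)
  have \<phi>_eq: "\<phi> = idn B \<boxplus> n"
    unfolding n_def
    using plus_comm[of \<phi> "neg (idn B)"] plus_assoc[of "idn B" "neg (idn B)" \<phi>] \<phi> B by simp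
  \<comment> \<open>Since \<open>n \<cdot> n\<close> vanishes, 1 - n inverts 1 + n.\<close>
  have "(idn B \<boxplus> neg n) \<cdot> \<phi> = idn B" "\<phi> \<cdot> (idn B \<boxplus> neg n) = idn B"
    unfolding \<phi>_eq using narr B nn
      plus_assoc[of "idn B" n "neg n"] plus_assoc[of "idn B" "neg n" n] by simp_all
  then show ?thesis using \<phi> narr B
    by (auto simp: iso_mor_arr intro!: exI[of _ "idn B \<boxplus> neg n"])
qed

section \<open>Biproducts\<close>

lemma biproduct_arr:
  assumes "biproduct A B S i j p q"
  shows "A \<in> Obj" "B \<in> Obj" "S \<in> Obj" "arr i" "src i = A" "tgt i = S" "arr j" "src j = B" "tgt j = S"
    "arr p" "src p = S" "tgt p = A" "arr q" "src q = S" "tgt q = B"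
    "p \<cdot> i = idn A" "q \<cdot> j = idn B" "p \<cdot> j = nul B A" "q \<cdot> i = nul A B"
    "(i \<cdot> p) \<boxplus> (j \<cdot> q) = idn S"
  using assms unfolding biproduct_def by auto

lemma biproduct_cancel:
  assumes "biproduct A B S i j p q" "arr x" "arr y"
  shows "tgt x = A \<Longrightarrow> p \<cdot> (i \<cdot> x) = x" "tgt x = A \<Longrightarrow> q \<cdot> (i \<cdot> x) = nul (src x) B"
    "tgt y = B \<Longrightarrow> q \<cdot> (j \<cdot> y) = y" "tgt y = B \<Longrightarrow> p \<cdot> (j \<cdot> y) = nul (src y) A"
  using biproduct_arr[OF assms(1)] assms(2,3)
    comp_eq_left[of p i] comp_eq_left[of q i] comp_eq_left[of p j] comp_eq_left[of q j] by simp_all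

lemma biproduct_ext_tgt:
  assumes "biproduct A B S i j p q" "arr x" "tgt x = S" "arr y" "tgt y = S" "src x = src y"
    and "p \<cdot> x = p \<cdot> y" "q \<cdot> x = q \<cdot> y"
  shows "x = y"
proof -
  note b = biproduct_arr[OF assms(1)]
  have *: "z = (i \<cdot> (p \<cdot> z)) \<boxplus> (j \<cdot> (q \<cdot> z))" if "arr z" "tgt z = S" for z
    using plus_comp[of z "i \<cdot> p" "j \<cdot> q"] b that by simp
  show ?thesis using *[of x] *[of y] assms by simp
qed

lemma biproduct_ext_src:
  assumes "biproduct A B S i j p q" "arr x" "src x = S" "arr y" "src y = S" "tgt x = tgt y"
    and "x \<cdot> i = y \<cdot> i" "x \<cdot> j = y \<cdot> j"
  shows "x = y"
proof -
  note b = biproduct_arr[OF assms(1)]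
  have *: "z = (z \<cdot> i) \<cdot> p \<boxplus> (z \<cdot> j) \<cdot> q" if "arr z" "src z = S" for z
    using comp_plus[of "i \<cdot> p" "j \<cdot> q" z] b that by simp
  show ?thesis using *[of x] *[of y] assms by simp
qed

lemma biproduct_pair:
  assumes "biproduct A B S i j p q" "arr u" "arr v" "src u = src v" "tgt u = A" "tgt v = B"
  obtains w where "arr w" "src w = src v" "tgt w = S" "p \<cdot> w = u" "q \<cdot> w = v"
  using that[of "i \<cdot> u \<boxplus> j \<cdot> v"] biproduct_arr[OF assms(1)] biproduct_cancel[OF assms(1-3)] assms
  by simp

lemma biproduct_copair:
  assumes "biproduct A B S i j p q" "arr u" "arr v" "src u = A" "src v = B" "tgt u = tgt v"
  obtains w where "arr w" "src w = S" "tgt w = tgt v" "w \<cdot> i = u" "w \<cdot> j = v"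
  using that[of "u \<cdot> p \<boxplus> v \<cdot> q"] biproduct_arr[OF assms(1)] assms by simp

lemma sum_mor_arr:
  assumes "biproduct A A' S i j p q" "biproduct B B' S' i' j' p' q'"
    and "arr f" "src f = A" "tgt f = B" "arr f'" "src f' = A'" "tgt f' = B'"
  defines "s \<equiv> sum_mor S S' i' j' p q f f'"
  shows "arr s" "src s = S" "tgt s = S'" "s \<cdot> i = i' \<cdot> f" "s \<cdot> j = j' \<cdot> f'"
    "p' \<cdot> s = f \<cdot> p" "q' \<cdot> s = f' \<cdot> q"
  unfolding s_def
  using biproduct_arr[OF assms(1)] biproduct_arr[OF assms(2)] assms(3-8)
    biproduct_cancel[OF assms(2), of "f \<cdot> p" "f' \<cdot> q"] by simp_all

lemma biproduct_zero_right:
  assumes "A \<in> Obj" "zero_object Z"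
  shows "biproduct A Z A (idn A) (nul Z A) (idn A) (nul A Z)"
  using assms unfolding biproduct_def zero_object_def by simp

lemma biproduct_zero_left:
  assumes "A \<in> Obj" "zero_object Z"
  shows "biproduct Z A A (nul Z A) (idn A) (nul A Z) (idn A)"
  using assms unfolding biproduct_def zero_object_def by simp

text \<open>The two idempotents of a decomposition add up to the identity, so locality makes one of
  them invertible. The projection onto the other summand kills that idempotent, hence is
  zero.\<close>

lemma local_End_indecomposable:
  assumes "local_End S"
  shows "indecomposable S"
  unfolding indecomposable_def
proof (intro conjI allI impI)
  show S: "S \<in> Obj" "\<not> zero_object S" using assms unfolding local_End_def zero_object_def by auto
  fix A B i j p q assume bip: "biproduct A B S i j p q"
  note b = biproduct_arr[OF bip]
  have "iso_mor S S (i \<cdot> p) \<or> iso_mor S S (j \<cdot> q)"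
    using assms b iso_idn[of S] unfolding local_End_def by force
  then show "zero_object A \<or> zero_object B"
  proof
    assume "iso_mor S S (i \<cdot> p)"
    then obtain g where g: "arr g" "src g = S" "tgt g = S" "i \<cdot> (p \<cdot> g) = idn S"
      using b by (auto simp: iso_mor_arr)
    have "q = q \<cdot> (i \<cdot> (p \<cdot> g))" using g b by simp
    also have "\<dots> = nul S B" using biproduct_cancel(2)[OF bip, of "p \<cdot> g"] b g(1-3) by simp
    finally show ?thesis using b unfolding zero_object_def by auto
  next
    assume "iso_mor S S (j \<cdot> q)"
    then obtain g where g: "arr g" "src g = S" "tgt g = S" "j \<cdot> (q \<cdot> g) = idn S"
      using b by (auto simp: iso_mor_arr)
    have "p = p \<cdot> (j \<cdot> (q \<cdot> g))" using g b by simp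
    also have "\<dots> = nul S A" using biproduct_cancel(4)[OF bip, of "q \<cdot> g" "q \<cdot> g"] b g(1-3) by simp
    finally show ?thesis using b unfolding zero_object_def by auto
  qed
qed

end

section \<open>Triangulated categories\<close>

context additive_autoequivalence
begin

lemma T_arr [simp]:
  assumes "arr f"
  shows "arr (Tm f)" "src (Tm f) = To (src f)" "tgt (Tm f) = To (tgt f)"
proof -
  have "Tm f \<in> Hom (To (src f)) (To (tgt f))"
    using T_fully_faithful[of "src f" "tgt f"] arr_hom[OF assms] assms
    unfolding bij_betw_def by auto
  then show "arr (Tm f)" "src (Tm f) = To (src f)" "tgt (Tm f) = To (tgt f)"
    using T_obj assms by auto
qed

declare T_obj [simp] T_id [simp]

lemma T_comp_arr [simp]:
  "arr f \<Longrightarrow> arr g \<Longrightarrow> tgt f = src g \<Longrightarrow> Tm (g \<cdot> f) = Tm g \<cdot> Tm f"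
  using T_comp[of "src f" "tgt f" "tgt g" f g] by simp

lemma T_plus [simp]:
  "arr f \<Longrightarrow> arr g \<Longrightarrow> src f = src g \<Longrightarrow> tgt f = tgt g \<Longrightarrow> Tm (f \<boxplus> g) = Tm f \<boxplus> Tm g"
  using T_add[of "src f" "tgt f" f g] by simp

lemma T_nul [simp]:
  assumes "A \<in> Obj" "B \<in> Obj"
  shows "Tm (nul A B) = nul (To A) (To B)"
proof -
  have "Tm (nul A B) \<boxplus> Tm (nul A B) = Tm (nul A B)"
    using T_plus[of "nul A B" "nul A B"] assms by simp
  then show ?thesis using plus_left_cancel[of "Tm (nul A B)" "Tm (nul A B)"] assms by simp
qed

lemma T_neg [simp]:
  assumes "arr f"
  shows "Tm (neg f) = neg (Tm f)"
proof -
  have "Tm f \<boxplus> Tm (neg f) = nul (To (src f)) (To (tgt f))"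
    using T_plus[of f "neg f"] assms by simp
  then show ?thesis using neg_unique[of "Tm f" "Tm (neg f)"] assms by simp
qed

lemma T_full:
  assumes "arr f" "src f = To A" "tgt f = To B" "A \<in> Obj" "B \<in> Obj"
  obtains g where "arr g" "src g = A" "tgt g = B" "Tm g = f"
proof -
  have "f \<in> Tm ` Hom A B" using T_fully_faithful[of A B] assms unfolding bij_betw_def by simp
  then show ?thesis using that assms by auto
qed

lemma T_faithful:
  assumes "Tm f = Tm g" "arr f" "arr g" "src f = src g" "tgt f = tgt g"
  shows "f = g"
  using T_fully_faithful[of "src f" "tgt f"] assms unfolding bij_betw_def inj_on_def by simp

lemma T_zero_object: "zero_object Z \<Longrightarrow> zero_object (To Z)"
  unfolding zero_object_def by (metis T_id T_nul T_obj)

lemma T_biproduct: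
  assumes "biproduct A B S i j p q"
  shows "biproduct (To A) (To B) (To S) (Tm i) (Tm j) (Tm p) (Tm q)"
proof -
  note b = biproduct_arr[OF assms]
  have "Tm (p \<cdot> i) = Tm (idn A)" "Tm (q \<cdot> j) = Tm (idn B)" "Tm (p \<cdot> j) = Tm (nul B A)"
    "Tm (q \<cdot> i) = Tm (nul A B)" "Tm (i \<cdot> p \<boxplus> j \<cdot> q) = Tm (idn S)"
    using b by (simp_all only:)
  with b(1-15) show ?thesis unfolding biproduct_def by simp
qed

end

context triangulated_category
begin

section \<open>Rotation of triangles\<close>

lemma tri_arr:
  assumes "tri A B D f g h"
  shows "A \<in> Obj" "B \<in> Obj" "D \<in> Obj" "arr f" "src f = A" "tgt f = B"
    "arr g" "src g = B" "tgt g = D" "arr h" "src h = D" "tgt h = To A"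
  using tri_typed[OF assms] by auto

lemma tri_iso:
  assumes "tri A B D f g h" "iso_mor A A' a" "iso_mor B B' b" "iso_mor D D' d"
    "arr f'" "arr g'" "arr h'" "src f' = A'" "tgt f' = B'" "src g' = B'" "tgt g' = D'"
    "src h' = D'" "tgt h' = To A'"
    "b \<cdot> f = f' \<cdot> a" "d \<cdot> g = g' \<cdot> b" "Tm a \<cdot> h = h' \<cdot> d"
  shows "tri A' B' D' f' g' h'"
proof -
  have "A' \<in> Obj" "B' \<in> Obj" "D' \<in> Obj" using assms(5-13) arr_obj by blast+
  then show ?thesis using TR1_iso[OF assms(1) _ _ _ _ _ _ assms(2-4,14-16)] assms(5-13) by simp
qed

lemma tri_rotate:
  assumes "arr f" "arr g" "arr h" "src f = A" "src g = B" "src h = D"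
    "tgt f = B" "tgt g = D" "tgt h = To A"
  shows "tri A B D f g h \<longleftrightarrow> tri B D (To A) g h (neg (Tm f))"
proof -
  have "A \<in> Obj" "B \<in> Obj" "D \<in> Obj" using assms arr_obj by blast+
  then show ?thesis using TR2[of A B D f g h] assms by simp
qed

lemma tri_rotate1: "tri A B D f g h \<Longrightarrow> tri B D (To A) g h (neg (Tm f))"
  using tri_rotate[of f g h A B D] tri_arr[of A B D f g h] by simp

lemma tri_rotate2: "tri A B D f g h \<Longrightarrow> tri D (To A) (To B) h (neg (Tm f)) (neg (Tm g))"
  by (intro tri_rotate1)

text \<open>Three rotations put a sign on all three shifted maps. The automorphism -1 of the middle
  object removes two of these signs.\<close>

lemma tri_rotate3:
  assumes fgh: "arr f" "arr g" "arr h" "src f = A" "src g = B" "src h = D"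
    "tgt f = B" "tgt g = D" "tgt h = To A"
    and T: "tri (To A) (To B) (To D) (Tm f) (Tm g) (neg (Tm h))"
  shows "tri A B D f g h"
proof -
  have obj: "A \<in> Obj" "B \<in> Obj" "D \<in> Obj" using assms arr_obj by blast+
  have "tri (To A) (To B) (To D) (neg (Tm f)) (neg (Tm g)) (neg (Tm h))"
    by (rule tri_iso[OF T iso_idn iso_neg_idn iso_idn]) (use fgh obj in simp_all)
  then show ?thesis
    using assms(1-9) obj tri_rotate[of f g h A B D] tri_rotate[of g h "neg (Tm f)" B D "To A"]
      tri_rotate[of h "neg (Tm f)" "neg (Tm g)" D "To A" "To B"] by simp
qed

section \<open>Completing morphisms of triangles\<close>

lemma tri_mor_12:
  assumes "tri A B D f g h" "tri A' B' D' f' g' h'"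
    and "arr a" "src a = A" "tgt a = A'" "arr b" "src b = B" "tgt b = B'" "b \<cdot> f = f' \<cdot> a"
  obtains d where "arr d" "src d = D" "tgt d = D'" "d \<cdot> g = g' \<cdot> b" "Tm a \<cdot> h = h' \<cdot> d"
  using TR3[OF assms(1,2) _ _ assms(9)] tri_arr[OF assms(1)] tri_arr[OF assms(2)] assms(3-8) by auto

text \<open>TR3 for the rotated triangles yields a map between \<open>To A\<close> and
  \<open>To A'\<close>; fullness of the shift brings it down to \<open>a\<close>, and faithfulness
  brings down the commuting square.\<close>

lemma tri_mor_23:
  assumes t: "tri A B D f g h" "tri A' B' D' f' g' h'"
    and "arr b" "src b = B" "tgt b = B'" "arr d" "src d = D" "tgt d = D'" "d \<cdot> g = g' \<cdot> b"
  obtains a where "arr a" "src a = A" "tgt a = A'" "b \<cdot> f = f' \<cdot> a" "Tm a \<cdot> h = h' \<cdot> d"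
proof -
  note ta = tri_arr[OF t(1)] tri_arr[OF t(2)]
  obtain k where k: "arr k" "src k = To A" "tgt k = To A'" "k \<cdot> h = h' \<cdot> d"
      "Tm b \<cdot> neg (Tm f) = neg (Tm f') \<cdot> k"
    using tri_mor_12[OF tri_rotate1[OF t(1)] tri_rotate1[OF t(2)] assms(3-9)] .
  then have k': "neg (Tm b \<cdot> Tm f) = neg (Tm f' \<cdot> k)" using ta assms(3-8) by simp
  obtain a where a: "arr a" "src a = A" "tgt a = A'" "Tm a = k"
    using T_full[OF k(1-3)] ta by blast
  have "neg (Tm (b \<cdot> f)) = neg (Tm (f' \<cdot> a))"
    using k'[folded a(4)] a(1-3) ta assms(3-8) by simp
  then have "Tm (b \<cdot> f) = Tm (f' \<cdot> a)" using a(1-3) ta assms(3-8) by (subst (asm) neg_inject) simp_all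
  then have "b \<cdot> f = f' \<cdot> a" by (rule T_faithful) (use a(1-3) ta assms(3-8) in simp_all)
  then show ?thesis using that a k by blast
qed

text \<open>The previous completion is applied to the rotated triangles, where the given pair
  \<open>d\<close> and \<open>Tm a\<close> occupies the last two places.\<close>

lemma tri_mor_13:
  assumes t: "tri A B D f g h" "tri A' B' D' f' g' h'"
    and "arr a" "src a = A" "tgt a = A'" "arr d" "src d = D" "tgt d = D'" "Tm a \<cdot> h = h' \<cdot> d"
  obtains b where "arr b" "src b = B" "tgt b = B'" "b \<cdot> f = f' \<cdot> a" "d \<cdot> g = g' \<cdot> b"
proof -
  note ta = tri_arr[OF t(1)] tri_arr[OF t(2)]
  obtain b where b: "arr b" "src b = B" "tgt b = B'" "d \<cdot> g = g' \<cdot> b"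
      "Tm b \<cdot> neg (Tm f) = neg (Tm f') \<cdot> Tm a"
    by (rule tri_mor_23[OF tri_rotate1[OF t(1)] tri_rotate1[OF t(2)] assms(6-8) _ _ _ assms(9)])
      (use assms(3-5) ta in simp_all)
  then have b': "neg (Tm b \<cdot> Tm f) = neg (Tm f' \<cdot> Tm a)" using ta assms(3-8) by simp
  have "neg (Tm (b \<cdot> f)) = neg (Tm (f' \<cdot> a))" using b' b(1-3) ta assms(3-8) by simp
  then have "Tm (b \<cdot> f) = Tm (f' \<cdot> a)" using b ta assms(3-8) by (subst (asm) neg_inject) simp_all
  then have "b \<cdot> f = f' \<cdot> a" by (rule T_faithful) (use b ta assms(3-8) in simp_all)
  then show ?thesis using that b by blast
qed

section \<open>Triangles on prescribed morphisms\<close>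

lemma tri_idn_zero: "A \<in> Obj \<Longrightarrow> zero_object Z \<Longrightarrow> tri A A Z (idn A) (nul A Z) (nul Z (To A))"
  by (rule TR1_id)

lemma tri_zero_idn:
  assumes "A \<in> Obj" "zero_object Z"
  shows "tri Z A A (nul Z A) (idn A) (nul A (To Z))"
proof -
  have Z: "Z \<in> Obj" using assms zero_object_def by simp
  have "tri A A (To Z) (idn A) (nul A (To Z)) (nul (To Z) (To A))"
    using tri_idn_zero assms T_zero_object by simp
  then show ?thesis using tri_rotate[of "nul Z A" "idn A" "nul A (To Z)" Z A A] assms Z by simp
qed

text \<open>A cone of \<open>\<delta>\<close> is rotated back twice. Its third object is only
  isomorphic to a shift, because the shift is merely an equivalence.\<close>

lemma tri_exists:
  assumes "arr \<delta>" "src \<delta> = D" "tgt \<delta> = To A" "A \<in> Obj"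
  obtains B f g where "tri A B D f g \<delta>"
proof -
  have D: "D \<in> Obj" using assms by auto
  obtain W k l where t: "tri D (To A) W \<delta> k l" using TR1_cone[of D "To A" \<delta>] assms D by auto
  note ta = tri_arr[OF t]
  obtain B s where B: "B \<in> Obj" and s: "iso_mor (To B) W s" using T_ess_surj ta by blast
  then obtain r where r: "arr s" "src s = To B" "tgt s = W" "arr r" "src r = W" "tgt r = To B"
      "r \<cdot> s = idn (To B)" "s \<cdot> r = idn W" using ta by (auto simp: iso_mor_arr)
  have ri: "iso_mor W (To B) r" using r B ta by (auto simp: iso_mor_arr)
  \<comment> \<open>The signs in the choice of \<open>f\<close> and \<open>g\<close> cancel those
    which the two rotations introduce.\<close>
  obtain f where f: "arr f" "src f = A" "tgt f = B" "Tm f = neg (r \<cdot> k)"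
    by (rule T_full[of "neg (r \<cdot> k)" A B]) (use r ta assms B in simp_all)
  obtain g where g: "arr g" "src g = B" "tgt g = D" "Tm g = neg (l \<cdot> s)"
    by (rule T_full[of "neg (l \<cdot> s)" B D]) (use r ta assms B in simp_all)
  have "tri D (To A) (To B) \<delta> (neg (Tm f)) (neg (Tm g))"
    by (rule tri_iso[OF t iso_idn iso_idn ri]) (use f g r ta assms B D in simp_all)
  then have "tri B D (To A) g \<delta> (neg (Tm f))"
    by (subst tri_rotate) (use f(1-3) g(1-3) assms B in simp_all)
  then have "tri A B D f g \<delta>"
    by (subst tri_rotate) (use f(1-3) g(1-3) assms B in simp_all)
  then show ?thesis by (rule that)
qed

lemma tri_exists_left:
  assumes "arr g" "src g = B" "tgt g = D"
  obtains A f h where "tri A B D f g h"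
proof -
  obtain F k l where t: "tri B D F g k l" using TR1_cone[of B D g] assms arr_obj by auto
  note ta = tri_arr[OF t]
  obtain A s where A: "A \<in> Obj" and s: "iso_mor (To A) F s" using T_ess_surj ta by blast
  then obtain r where r: "arr s" "src s = To A" "tgt s = F" "arr r" "src r = F" "tgt r = To A"
      "r \<cdot> s = idn (To A)" "s \<cdot> r = idn F" using ta by (auto simp: iso_mor_arr)
  have ri: "iso_mor F (To A) r" using r A ta by (auto simp: iso_mor_arr)
  obtain f where f: "arr f" "src f = A" "tgt f = B" "Tm f = neg (l \<cdot> s)"
    by (rule T_full[of "neg (l \<cdot> s)" A B]) (use r ta assms A in simp_all)
  have "tri B D (To A) g (r \<cdot> k) (neg (Tm f))"
    by (rule tri_iso[OF t iso_idn iso_idn ri]) (use f r ta assms A in simp_all)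
  then have "tri A B D f g (r \<cdot> k)"
    by (subst tri_rotate) (use f(1-3) r ta assms A in simp_all)
  then show ?thesis by (rule that)
qed

text \<open>Weak kernel property: \<open>u\<close> is completed to a morphism from the triangle on
  the identity of \<open>W\<close>, and its first component is the factorisation.\<close>

lemma tri_factor_1:
  assumes t: "tri A B D f g h"
    and u: "arr u" "src u = W" "tgt u = B" "g \<cdot> u = nul W D"
  obtains v where "arr v" "src v = W" "tgt v = A" "f \<cdot> v = u"
proof -
  note ta = tri_arr[OF t]
  have W: "W \<in> Obj" using u by auto
  obtain Z where Z: "zero_object Z" using has_zero_object by blast
  then have Zo: "Z \<in> Obj" by (simp add: zero_object_def)
  obtain v where v: "arr v" "src v = W" "tgt v = A" "u \<cdot> idn W = f \<cdot> v"
    by (rule tri_mor_23[OF tri_idn_zero[OF W Z] t, of u "nul Z D"]) (use ta u W Zo in simp_all)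
  then show ?thesis using that[of v] u by simp
qed

lemma tri_factor_3:
  assumes t: "tri A B D f g h"
    and u: "arr u" "src u = W" "tgt u = D" "h \<cdot> u = nul W (To A)"
  obtains v where "arr v" "src v = W" "tgt v = B" "g \<cdot> v = u"
  using tri_factor_1[OF tri_rotate1[OF t] u] .

text \<open>Dually, \<open>u\<close> extends along \<open>f\<close> by completing a morphism into
  the triangle on the identity of \<open>W\<close>.\<close>

lemma tri_factor_0:
  assumes t: "tri A B D f g h"
    and u: "arr u" "src u = A" "tgt u = W" "Tm u \<cdot> h = nul D (To W)"
  obtains v where "arr v" "src v = B" "tgt v = W" "v \<cdot> f = u"
proof -
  note ta = tri_arr[OF t]
  have W: "W \<in> Obj" using u by auto
  obtain Z where Z: "zero_object Z" using has_zero_object by blast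
  then have Zo: "Z \<in> Obj" by (simp add: zero_object_def)
  obtain v where v: "arr v" "src v = B" "tgt v = W" "v \<cdot> f = idn W \<cdot> u"
    by (rule tri_mor_13[OF t tri_idn_zero[OF W Z], of u "nul D Z"]) (use ta u W Zo in simp_all)
  then show ?thesis using that[of v] u by simp
qed

lemma tri_comp_zero:
  assumes t: "tri A B D f g h"
  shows "g \<cdot> f = nul A D"
proof -
  note ta = tri_arr[OF t]
  obtain Z where Z: "zero_object Z" using has_zero_object by blast
  then have Zo: "Z \<in> Obj" by (simp add: zero_object_def)
  obtain d where d: "arr d" "src d = Z" "tgt d = D" "d \<cdot> nul A Z = g \<cdot> f"
    by (rule tri_mor_12[OF tri_idn_zero[of A, OF _ Z] t, of "idn A" f]) (use ta in simp_all)
  then show ?thesis using ta Zo by simp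
qed

lemma tri_comp_zero_2: "tri A B D f g h \<Longrightarrow> h \<cdot> g = nul B (To A)"
  by (rule tri_comp_zero[OF tri_rotate1])

lemma tri_comp_zero_3:
  assumes "tri A B D f g h"
  shows "Tm f \<cdot> h = nul D (To B)"
proof -
  note ta = tri_arr[OF assms]
  have "neg (Tm f) \<cdot> h = nul D (To B)" by (rule tri_comp_zero[OF tri_rotate2[OF assms]])
  then have "neg (Tm f \<cdot> h) = neg (nul D (To B))" using ta by simp
  then show ?thesis using ta by (subst (asm) neg_inject) simp_all
qed

text \<open>\<open>g\<close> kills \<phi> - 1, so this difference factors through \<open>f\<close>,
  while \<phi> fixes \<open>f\<close>; thus \<phi> - 1 squares to zero.\<close>

lemma tri_endo_iso:
  assumes t: "tri A B D f g h" and "arr \<phi>" "src \<phi> = B" "tgt \<phi> = B" "\<phi> \<cdot> f = f" "g \<cdot> \<phi> = g"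
  shows "iso_mor B B \<phi>"
proof -
  note ta = tri_arr[OF t]
  obtain v where "arr v" "src v = B" "tgt v = A" "f \<cdot> v = \<phi> \<boxplus> neg (idn B)"
    by (rule tri_factor_1[OF t, of "\<phi> \<boxplus> neg (idn B)"]) (use assms ta in simp_all)
  then show ?thesis using iso_if_square_zero[of \<phi> B f v] assms ta by simp
qed

text \<open>This stands in for the five lemma: a comparison in the other direction exists, and both
  composites are endomorphisms compatible with the outer maps of a triangle.\<close>

lemma tri_middle_iso:
  assumes t: "tri A B D f g h" "tri A B' D f' g' h"
    and b: "arr b" "src b = B" "tgt b = B'" "b \<cdot> f = f'" "g' \<cdot> b = g"
  shows "iso_mor B B' b"
proof -
  note ta = tri_arr[OF t(1)] tri_arr[OF t(2)]
  obtain c where c: "arr c" "src c = B'" "tgt c = B" "c \<cdot> f' = f \<cdot> idn A" "idn D \<cdot> g' = g \<cdot> c"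
    by (rule tri_mor_13[OF t(2,1), of "idn A" "idn D"]) (use ta in simp_all)
  have "iso_mor B B (c \<cdot> b)" by (rule tri_endo_iso[OF t(1)])
      (use b c ta comp_eq_left[of g c g' b] in simp_all)
  moreover have "iso_mor B' B' (b \<cdot> c)" by (rule tri_endo_iso[OF t(2)])
      (use b c ta comp_eq_left[of g' b g c] in simp_all)
  ultimately show ?thesis using iso_cancel[of b c] b c by simp
qed

text \<open>The summed connecting morphism \<Delta> is completed to a triangle with middle term
  \<open>G\<close>, which is then shown to be isomorphic to the direct sum of the two
  sequences.\<close>

lemma tri_sum:
  assumes t: "tri A B D x y \<delta>" "tri A' B' D' x' y' \<delta>'"
    and SA: "biproduct A A' SA iA jA pA qA" and SB: "biproduct B B' SB iB jB pB qB"
    and SD: "biproduct D D' SD iD jD pD qD"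
  shows "tri SA SB SD (sum_mor SA SB iB jB pA qA x x') (sum_mor SB SD iD jD pB qB y y')
    (Tm iA \<cdot> \<delta> \<cdot> pD \<boxplus> Tm jA \<cdot> \<delta>' \<cdot> qD)"
proof -
  note ta = tri_arr[OF t(1)] tri_arr[OF t(2)]
  note ba = biproduct_arr[OF SA] biproduct_arr[OF SB] biproduct_arr[OF SD]
  define X Y \<Delta> where "X = sum_mor SA SB iB jB pA qA x x'" and "Y = sum_mor SB SD iD jD pB qB y y'"
    and "\<Delta> = Tm iA \<cdot> \<delta> \<cdot> pD \<boxplus> Tm jA \<cdot> \<delta>' \<cdot> qD"
  note X = sum_mor_arr[OF SA SB ta(4-6) ta(16-18), folded X_def]
  note Y = sum_mor_arr[OF SB SD ta(7-9) ta(19-21), folded Y_def]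
  have \<Delta>: "arr \<Delta>" "src \<Delta> = SD" "tgt \<Delta> = To SA" unfolding \<Delta>_def using ta ba by simp_all
  have \<Delta>i: "\<Delta> \<cdot> iD = Tm iA \<cdot> \<delta>" "\<Delta> \<cdot> jD = Tm jA \<cdot> \<delta>'"
    unfolding \<Delta>_def using ta ba by simp_all
  have \<Delta>p: "Tm pA \<cdot> \<Delta> = \<delta> \<cdot> pD" "Tm qA \<cdot> \<Delta> = \<delta>' \<cdot> qD"
    unfolding \<Delta>_def using ta ba
      biproduct_cancel[OF T_biproduct[OF SA], of "\<delta> \<cdot> pD" "\<delta>' \<cdot> qD"] by simp_all
  obtain G f g where G: "tri SA G SD f g \<Delta>" using tri_exists[OF \<Delta>] ba by blast
  note tG = tri_arr[OF G]
  \<comment> \<open>The injections and projections intertwine \<delta> and \<delta>' with \<Delta>,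
    so each of them lifts to the middle terms. The four lifts assemble into \<open>b\<close> and
    \<open>c\<close>.\<close>
  obtain b1 where b1: "arr b1" "src b1 = B" "tgt b1 = G" "b1 \<cdot> x = f \<cdot> iA" "iD \<cdot> y = g \<cdot> b1"
    by (rule tri_mor_13[OF t(1) G, of iA iD]) (use ba \<Delta>i in simp_all)
  obtain b2 where b2: "arr b2" "src b2 = B'" "tgt b2 = G" "b2 \<cdot> x' = f \<cdot> jA" "jD \<cdot> y' = g \<cdot> b2"
    by (rule tri_mor_13[OF t(2) G, of jA jD]) (use ba \<Delta>i in simp_all)
  obtain c1 where c1: "arr c1" "src c1 = G" "tgt c1 = B" "c1 \<cdot> f = x \<cdot> pA" "pD \<cdot> g = y \<cdot> c1"
    by (rule tri_mor_13[OF G t(1), of pA pD]) (use ba \<Delta>p in simp_all)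
  obtain c2 where c2: "arr c2" "src c2 = G" "tgt c2 = B'" "c2 \<cdot> f = x' \<cdot> qA" "qD \<cdot> g = y' \<cdot> c2"
    by (rule tri_mor_13[OF G t(2), of qA qD]) (use ba \<Delta>p in simp_all)
  obtain b where b: "arr b" "src b = SB" "tgt b = G" "b \<cdot> iB = b1" "b \<cdot> jB = b2"
    using biproduct_copair[OF SB b1(1) b2(1)] b1 b2 by metis
  obtain c where c: "arr c" "src c = G" "tgt c = SB" "pB \<cdot> c = c1" "qB \<cdot> c = c2"
    using biproduct_pair[OF SB c1(1) c2(1)] c1 c2 by metis
  have bX: "b \<cdot> X = f"
  proof (rule biproduct_ext_src[OF SA])
    show "(b \<cdot> X) \<cdot> iA = f \<cdot> iA" "(b \<cdot> X) \<cdot> jA = f \<cdot> jA"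
      using b b1 b2 X ta ba comp_eq_left[of b iB b1 x] comp_eq_left[of b jB b2 x'] by simp_all
  qed (use b X tG in simp_all)
  have gb: "g \<cdot> b = Y"
  proof (rule biproduct_ext_src[OF SB])
    show "(g \<cdot> b) \<cdot> iB = Y \<cdot> iB" "(g \<cdot> b) \<cdot> jB = Y \<cdot> jB"
      using b b1 b2 Y ta ba tG by simp_all
  qed (use b Y tG in simp_all)
  have cf: "c \<cdot> f = X"
  proof (rule biproduct_ext_tgt[OF SB])
    show "pB \<cdot> (c \<cdot> f) = pB \<cdot> X" "qB \<cdot> (c \<cdot> f) = qB \<cdot> X"
      using c c1 c2 X ta ba tG comp_eq_left[of pB c c1 f] comp_eq_left[of qB c c2 f] by simp_all
  qed (use c X tG in simp_all)
  have Yc: "Y \<cdot> c = g"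
  proof (rule biproduct_ext_tgt[OF SD])
    show "pD \<cdot> (Y \<cdot> c) = pD \<cdot> g" "qD \<cdot> (Y \<cdot> c) = qD \<cdot> g"
      using c c1 c2 Y ta ba tG comp_eq_left[of pD Y "y \<cdot> pB" c] comp_eq_left[of qD Y "y' \<cdot> qB" c]
      by simp_all
  qed (use c Y tG in simp_all)
  have "iso_mor G G (b \<cdot> c)"
    by (rule tri_endo_iso[OF G]) (use b c tG bX gb cf Yc comp_eq_left[of g b Y c] in simp_all)
  \<comment> \<open>The sum sequence is not yet known to be a triangle, so
    \<open>tri_endo_iso\<close> does not apply to it. Instead the deviation \<open>n\<close> from
    the identity is factored through \<open>X\<close> componentwise, using the two given
    triangles.\<close>
  moreover have "iso_mor SB SB (c \<cdot> b)"
  proof -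
    define n where "n = c \<cdot> b \<boxplus> neg (idn SB)"
    have n: "arr n" "src n = SB" "tgt n = SB" unfolding n_def using b c ba by simp_all
    have "Y \<cdot> (c \<cdot> b) = Y" using comp_eq_left[of Y c g b] b c Y gb Yc by simp
    then have Yn: "Y \<cdot> n = nul SB SD" unfolding n_def using b c Y ba by simp
    have yn: "y \<cdot> (pB \<cdot> n) = nul SB D" "y' \<cdot> (qB \<cdot> n) = nul SB D'"
      using comp_eq_left[of pD Y "y \<cdot> pB" n] comp_eq_left[of qD Y "y' \<cdot> qB" n] n ba ta Y Yn
      by simp_all
    obtain v1 where v1: "arr v1" "src v1 = SB" "tgt v1 = A" "x \<cdot> v1 = pB \<cdot> n"
      using tri_factor_1[OF t(1), of "pB \<cdot> n"] yn n ba by auto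
    obtain v2 where v2: "arr v2" "src v2 = SB" "tgt v2 = A'" "x' \<cdot> v2 = qB \<cdot> n"
      using tri_factor_1[OF t(2), of "qB \<cdot> n"] yn n ba by auto
    obtain v where v: "arr v" "src v = SB" "tgt v = SA" "pA \<cdot> v = v1" "qA \<cdot> v = v2"
      using biproduct_pair[OF SA v1(1) v2(1)] v1 v2 by metis
    have "n = X \<cdot> v"
    proof (rule biproduct_ext_tgt[OF SB])
      show "pB \<cdot> n = pB \<cdot> (X \<cdot> v)" "qB \<cdot> n = qB \<cdot> (X \<cdot> v)"
        using v v1 v2 X ta ba comp_eq_left[of pB X "x \<cdot> pA" v] comp_eq_left[of qB X "x' \<cdot> qA" v]
        by simp_all
    qed (use v X n in simp_all)
    then show ?thesis
      by (intro iso_if_square_zero[of _ _ X v]) (use v X b c n_def bX cf in simp_all)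
  qed
  ultimately have ci: "iso_mor G SB c" using iso_cancel[of c b] b c by simp
  have "tri SA SB SD X Y \<Delta>"
    by (rule tri_iso[OF G iso_idn ci iso_idn]) (use X Y \<Delta> ba tG cf Yc in simp_all)
  then show ?thesis unfolding X_def Y_def \<Delta>_def .
qed

text \<open>This is the direct sum of the triangles A = A -> 0 and 0 -> D = D.\<close>

lemma tri_split:
  assumes "biproduct A D S i j p q"
  shows "tri A S D i q (nul D (To A))"
proof -
  note b = biproduct_arr[OF assms]
  obtain Z where Z: "zero_object Z" using has_zero_object by blast
  then have Zo: "Z \<in> Obj" by (simp add: zero_object_def)
  show ?thesis
    using tri_sum[OF tri_idn_zero[of A, OF _ Z] tri_zero_idn[of D, OF _ Z]
        biproduct_zero_right[of A, OF _ Z] assms biproduct_zero_left[of D, OF _ Z]] b Zo by simp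
qed

text \<open>The triangle is isomorphic to the split one with the same zero connecting morphism, and
  the biproduct structure is transported along this isomorphism.\<close>

lemma tri_zero_biproduct:
  assumes "tri A B D f g (nul D (To A))"
  shows "\<exists>j p. biproduct A D B f j p g"
proof -
  note ta = tri_arr[OF assms]
  obtain S i j p q where bip: "biproduct A D S i j p q" using has_biproducts ta by blast
  note b = biproduct_arr[OF bip]
  note t = tri_split[OF bip]
  obtain c where c: "arr c" "src c = S" "tgt c = B" "c \<cdot> i = f" "g \<cdot> c = q"
    by (rule tri_mor_13[OF t assms, of "idn A" "idn D"]) (use ta b in simp_all)
  have "iso_mor S B c" by (rule tri_middle_iso[OF t assms]) (use c b ta in simp_all)
  then obtain c' where c': "arr c'" "src c' = B" "tgt c' = S" "c' \<cdot> c = idn S" "c \<cdot> c' = idn B"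
    using ta b by (auto simp: iso_mor_arr)
  have qc: "q \<cdot> c' = g" using comp_eq_left[of g c q c'] c c' ta by simp
  have ci: "c' \<cdot> f = i" using comp_eq_left[of c' c "idn S" i] c c' ta b by simp
  have "c \<cdot> ((i \<cdot> p \<boxplus> j \<cdot> q) \<cdot> c') = idn B" using b(3,20) c c' by simp
  then have "f \<cdot> (p \<cdot> c') \<boxplus> (c \<cdot> j) \<cdot> g = idn B"
    using comp_eq_left[of c i f "p \<cdot> c'"] b(1-19) c c' ta qc by simp
  then have "biproduct A D B f (c \<cdot> j) (p \<cdot> c') g"
    unfolding biproduct_def
    using b c c' ta qc ci comp_eq_left[of c' c "idn S" j] comp_eq_left[of g c q j]
      tri_comp_zero[OF assms] by simp
  then show ?thesis by blast
qed

end

section \<open>Morphisms orthogonal to a subcategory\<close>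

context additive_category
begin

section \<open>Testing vanishing on direct summands\<close>

lemma direct_sum_subcategory:
  assumes "direct_sum As S" "subcategory X"
  shows "S \<in> X \<longleftrightarrow> set As \<subseteq> X"
  using assms
proof (induction rule: direct_sum.induct)
  case (1 Z)
  then show ?case unfolding subcategory_def by simp
next
  case (2 As B A S i j p q)
  then have "S \<in> X \<longleftrightarrow> A \<in> X \<and> B \<in> X" unfolding subcategory_def by blast
  then show ?case using 2(3)[OF 2(4)] by simp
qed

lemma direct_sum_single:
  assumes "A \<in> Obj"
  shows "direct_sum [A] A"
proof -
  obtain Z where Z: "zero_object Z" using has_zero_object by blast
  show ?thesis
    using direct_sum.intros(2)[OF direct_sum.intros(1)[OF Z] biproduct_zero_right[OF assms Z]] .
qed

lemma direct_sum_comp_zero_src: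
  assumes "direct_sum As S" "arr \<delta>"
    and "\<And>v. arr v \<Longrightarrow> tgt v = src \<delta> \<Longrightarrow> src v \<in> set As \<Longrightarrow> \<delta> \<cdot> v = nul (src v) (tgt \<delta>)"
  shows "arr v \<Longrightarrow> src v = S \<Longrightarrow> tgt v = src \<delta> \<Longrightarrow> \<delta> \<cdot> v = nul S (tgt \<delta>)"
  using assms
proof (induction arbitrary: v rule: direct_sum.induct)
  case (1 Z)
  then have "v = nul Z (src \<delta>)" using zero_object_arr(1) by metis
  then show ?case using 1(1,5) by (simp add: zero_object_def)
next
  case (2 As B A S i j p q)
  note b = biproduct_arr[OF 2(2)]
  note v = 2(4-7)
  have "\<delta> \<cdot> (v \<cdot> j) = nul B (tgt \<delta>)" by (rule 2(3)) (use v b 2(8) in auto)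
  moreover have "\<delta> \<cdot> (v \<cdot> i) = nul A (tgt \<delta>)" using 2(8)[of "v \<cdot> i"] v b by simp
  ultimately have "(\<delta> \<cdot> v) \<cdot> i = nul S (tgt \<delta>) \<cdot> i" "(\<delta> \<cdot> v) \<cdot> j = nul S (tgt \<delta>) \<cdot> j"
    using v b by simp_all
  then show ?case by (rule biproduct_ext_src[OF 2(2), rotated 5]) (use v b in simp_all)
qed

end

context triangulated_category
begin

lemma direct_sum_comp_zero_tgt:
  assumes "direct_sum As S" "arr \<delta>" "tgt \<delta> = To A"
    and "\<And>u. arr u \<Longrightarrow> src u = A \<Longrightarrow> tgt u \<in> set As \<Longrightarrow> Tm u \<cdot> \<delta> = nul (src \<delta>) (To (tgt u))"
  shows "arr u \<Longrightarrow> src u = A \<Longrightarrow> tgt u = S \<Longrightarrow> Tm u \<cdot> \<delta> = nul (src \<delta>) (To S)"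
  using assms
proof (induction arbitrary: u rule: direct_sum.induct)
  case (1 Z)
  then have "u = nul A Z" using zero_object_arr(2) by metis
  then show ?case using 1(1-3,5-6) arr_obj[of u] by (simp add: zero_object_def)
next
  case (2 As B D S i j p q)
  note b = biproduct_arr[OF 2(2)]
  note u = 2(4-8)
  have "Tm (q \<cdot> u) \<cdot> \<delta> = nul (src \<delta>) (To B)" by (rule 2(3)) (use u b 2(9) in auto)
  moreover have "Tm (p \<cdot> u) \<cdot> \<delta> = nul (src \<delta>) (To D)" using 2(9)[of "p \<cdot> u"] u b by simp
  ultimately have "Tm p \<cdot> (Tm u \<cdot> \<delta>) = Tm p \<cdot> nul (src \<delta>) (To S)"
      "Tm q \<cdot> (Tm u \<cdot> \<delta>) = Tm q \<cdot> nul (src \<delta>) (To S)"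
    using u b by simp_all
  then show ?case by (rule biproduct_ext_tgt[OF T_biproduct[OF 2(2)], rotated 5]) (use u b in simp_all)
qed

text \<open>For \<open>\<delta>\<close> the last map of a triangle this says that the second map is
  \<open>X\<close>-epic. It refers to \<open>\<delta>\<close> alone and not to a chosen
  triangle.\<close>

definition ghost_in :: "'o set \<Rightarrow> 'm \<Rightarrow> bool" where
  "ghost_in X \<delta> \<longleftrightarrow>
     (\<forall>v. arr v \<longrightarrow> src v \<in> X \<longrightarrow> tgt v = src \<delta> \<longrightarrow> \<delta> \<cdot> v = nul (src v) (tgt \<delta>))"

text \<open>The object \<open>A\<close> is a parameter because the shift need not be injective on
  objects, so the target \<open>To A\<close> does not determine it.\<close>

definition ghost_out :: "'o set \<Rightarrow> 'o \<Rightarrow> 'm \<Rightarrow> bool" where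
  "ghost_out X A \<delta> \<longleftrightarrow>
     (\<forall>u. arr u \<longrightarrow> src u = A \<longrightarrow> tgt u \<in> X \<longrightarrow> Tm u \<cdot> \<delta> = nul (src \<delta>) (To (tgt u)))"

text \<open>By exactness of the contravariant Hom sequence, \<open>u\<close> extends along
  \<open>f\<close> exactly when \<open>Tm u \<cdot> \<delta>\<close> vanishes.\<close>

lemma X_monic_iff_ghost_out:
  assumes t: "tri A B D f g \<delta>" and X: "X \<subseteq> Obj"
  shows "X_monic X A B f \<longleftrightarrow> ghost_out X A \<delta>"
proof
  note ta = tri_arr[OF t]
  assume m: "X_monic X A B f"
  show "ghost_out X A \<delta>" unfolding ghost_out_def
  proof (intro allI impI)
    fix u assume u: "arr u" "src u = A" "tgt u \<in> X"
    define W where "W = tgt u"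
    have W: "W \<in> Obj" "W \<in> X" "u \<in> Hom A W" using u ta W_def by auto
    then have "u \<in> (\<lambda>v. v \<cdot> f) ` Hom B W" using m unfolding X_monic_def by simp
    then obtain v where v: "v \<in> Hom B W" "u = v \<cdot> f" by blast
    then have va: "arr v" "src v = B" "tgt v = W" using ta W by simp_all
    have "Tm u \<cdot> \<delta> = Tm v \<cdot> (Tm f \<cdot> \<delta>)" unfolding v(2) using va ta by simp
    also have "\<dots> = nul D (To W)" unfolding tri_comp_zero_3[OF t] using va ta by simp
    finally show "Tm u \<cdot> \<delta> = nul (src \<delta>) (To (tgt u))" unfolding W_def using ta by simp
  qed
next
  note ta = tri_arr[OF t]
  assume g: "ghost_out X A \<delta>"
  have "(\<lambda>v. v \<cdot> f) ` Hom B Y = Hom A Y" if Y: "Y \<in> X" for Y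
  proof (intro equalityI subsetI)
    have YO: "Y \<in> Obj" using Y X by blast
    show "w \<in> Hom A Y" if "w \<in> (\<lambda>v. v \<cdot> f) ` Hom B Y" for w using that ta YO by auto
    fix u assume "u \<in> Hom A Y"
    then have u: "arr u" "src u = A" "tgt u = Y" using ta YO by auto
    then have "Tm u \<cdot> \<delta> = nul D (To Y)" using g Y ta unfolding ghost_out_def by auto
    then obtain v where "arr v" "src v = B" "tgt v = Y" "v \<cdot> f = u"
      by (rule tri_factor_0[OF t u])
    then show "u \<in> (\<lambda>v. v \<cdot> f) ` Hom B Y" using ta YO by auto
  qed
  then show "X_monic X A B f" unfolding X_monic_def using ta by auto
qed

section \<open>Auslander-Reiten triangles and ghosts\<close>

lemma ar_connecting_nonzero:
  assumes "ar_triangle A B D f g \<eta>"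
  shows "\<eta> \<noteq> nul D (To A)"
proof
  assume z: "\<eta> = nul D (To A)"
  have t: "tri A B D f g \<eta>" and s: "source_mor A B f" using assms ar_triangle_def by auto
  note ta = tri_arr[OF t]
  obtain v where v: "arr v" "src v = B" "tgt v = A" "v \<cdot> f = idn A"
    by (rule tri_factor_0[OF t, of "idn A"]) (use ta z in simp_all)
  then have "section_mor A B f" unfolding section_mor_def using ta by auto
  then show False using s unfolding source_mor_def by simp
qed

text \<open>As \<delta> is nonzero, the second map \<open>g\<close> of its triangle is no retraction
  and factors through the sink morphism \<beta>. Completing with the identity of \<open>Y\<close>
  gives \<open>u\<close>.\<close>

lemma ar_factor_out:
  assumes ar: "ar_triangle A' B' Y \<alpha> \<beta> \<eta>"
    and \<delta>: "arr \<delta>" "src \<delta> = Y" "tgt \<delta> = To A" "A \<in> Obj" "\<delta> \<noteq> nul Y (To A)"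
  obtains u where "arr u" "src u = A" "tgt u = A'" "Tm u \<cdot> \<delta> = \<eta>"
proof -
  have t': "tri A' B' Y \<alpha> \<beta> \<eta>" and sink: "sink_mor B' Y \<beta>" using ar ar_triangle_def by auto
  obtain B f g where t: "tri A B Y f g \<delta>" using tri_exists[OF \<delta>(1-4)] .
  note ta = tri_arr[OF t] tri_arr[OF t']
  have "\<not> retraction_mor B Y g"
  proof
    assume "retraction_mor B Y g"
    then obtain s where s: "arr s" "src s = Y" "tgt s = B" "g \<cdot> s = idn Y"
      unfolding retraction_mor_def using ta by auto
    have "(\<delta> \<cdot> g) \<cdot> s = \<delta>" using s ta by simp
    then show False unfolding tri_comp_zero_2[OF t] using s ta \<delta>(5) by simp
  qed
  then obtain v where v: "v \<in> Hom B B'" "g = \<beta> \<cdot> v"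
    using sink ta unfolding sink_mor_def by (metis hom_iff)
  then have va: "arr v" "src v = B" "tgt v = B'" using ta by auto
  obtain u where "arr u" "src u = A" "tgt u = A'" "v \<cdot> f = \<alpha> \<cdot> u" "Tm u \<cdot> \<delta> = \<eta> \<cdot> idn Y"
    by (rule tri_mor_23[OF t t' va, of "idn Y"]) (use ta va v in simp_all)
  then show ?thesis using that ta by simp
qed

text \<open>Dually, the first map of the triangle on \<delta> is no section and factors through the
  source morphism \<alpha>.\<close>

lemma ar_factor_in:
  assumes ar: "ar_triangle Y B' W \<alpha> \<beta> \<eta>"
    and \<delta>: "arr \<delta>" "src \<delta> = D" "tgt \<delta> = To Y" "\<delta> \<noteq> nul D (To Y)"
  obtains w where "arr w" "src w = W" "tgt w = D" "\<delta> \<cdot> w = \<eta>"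
proof -
  have t': "tri Y B' W \<alpha> \<beta> \<eta>" and source: "source_mor Y B' \<alpha>" using ar ar_triangle_def by auto
  obtain B f g where t: "tri Y B D f g \<delta>" using tri_exists[OF \<delta>(1-3)] tri_arr(1)[OF t'] .
  note ta = tri_arr[OF t] tri_arr[OF t']
  have "\<not> section_mor Y B f"
  proof
    assume "section_mor Y B f"
    then obtain s where s: "arr s" "src s = B" "tgt s = Y" "s \<cdot> f = idn Y"
      unfolding section_mor_def using ta by auto
    have "\<delta> = Tm (s \<cdot> f) \<cdot> \<delta>" unfolding s(4) using ta by simp
    also have "\<dots> = Tm s \<cdot> (Tm f \<cdot> \<delta>)" using s(1-3) ta by simp
    also have "\<dots> = nul D (To Y)" unfolding tri_comp_zero_3[OF t] using s(1-3) ta by simp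
    finally show False using \<delta>(4) by simp
  qed
  then obtain v where v: "v \<in> Hom B' B" "f = v \<cdot> \<alpha>"
    using source ta unfolding source_mor_def by (metis hom_iff)
  then have va: "arr v" "src v = B'" "tgt v = B" using ta by auto
  obtain w where "arr w" "src w = W" "tgt w = D" "w \<cdot> \<beta> = g \<cdot> v" "Tm (idn Y) \<cdot> \<eta> = \<delta> \<cdot> w"
    by (rule tri_mor_12[OF t' t, of "idn Y" v]) (use ta va v in simp_all)
  then show ?thesis using that ta by simp
qed

text \<open>If \<open>\<delta> \<cdot> v \<noteq> 0\<close> for
  an indecomposable \<open>Y \<in> X\<close>, then the connecting morphism of the Auslander--Reiten triangle
  ending in \<open>Y\<close> factors through \<open>\<delta> \<cdot> v\<close> by a morphism out of \<open>A\<close> into \<open>\<tau> Y \<in> X\<close>; dually for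
  morphisms into \<open>X\<close>.\<close>

lemma ghost_out_iff_ghost_in:
  assumes ks: "\<And>A. A \<in> Obj \<Longrightarrow> \<exists>As. direct_sum As A \<and> (\<forall>B\<in>set As. local_End B)"
    and ar: "has_AR_translation" and X: "subcategory X" and tau: "tau_image X = X"
    and \<delta>: "arr \<delta>" "tgt \<delta> = To A" "A \<in> Obj"
  shows "ghost_out X A \<delta> \<longleftrightarrow> ghost_in X \<delta>"
proof
  have XO: "X \<subseteq> Obj" using X subcategory_def by auto
  define D where "D = src \<delta>"
  note \<delta> = \<delta> D_def[symmetric]
  {
    assume out: "ghost_out X A \<delta>"
    show "ghost_in X \<delta>" unfolding ghost_in_def
    proof (intro allI impI)
      fix v assume v: "arr v" "src v \<in> X" "tgt v = src \<delta>"
      \<comment> \<open>The Krull-Schmidt property reduces the claim to summands of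
        \<open>src v\<close>; they are indecomposable and belong to \<open>X\<close>.\<close>
      obtain As where As: "direct_sum As (src v)" "\<forall>B\<in>set As. local_End B"
        using ks v by (meson arr_obj(1))
      have "\<delta> \<cdot> w = nul (src w) (tgt \<delta>)"
        if w: "arr w" "tgt w = src \<delta>" "src w \<in> set As" for w
      proof (rule ccontr)
        define Y where "Y = src w"
        have Y: "indecomposable Y" "Y \<in> X"
          using direct_sum_subcategory[OF As(1) X] v(2) w(3) As(2) local_End_indecomposable
          unfolding Y_def by auto
        then obtain A' B' \<alpha> \<beta> \<eta> where t: "ar_triangle A' B' Y \<alpha> \<beta> \<eta>"
          using ar unfolding has_AR_translation_def by blast
        then have t': "tri A' B' Y \<alpha> \<beta> \<eta>" using ar_triangle_def by auto
        note ta = tri_arr[OF t']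
        \<comment> \<open>One-term decompositions show that \<open>A'\<close> is a translate of
          \<open>Y\<close>; here \<open>tau_image X\<close> being contained in \<open>X\<close> is
          used.\<close>
        have "AR_translate A' Y" unfolding AR_translate_def
          by (rule exI[of _ "[A']"], rule exI[of _ "[Y]"])
            (use t ta direct_sum_single in auto)
        then have A': "A' \<in> X" using Y tau unfolding tau_image_def by blast
        assume "\<delta> \<cdot> w \<noteq> nul (src w) (tgt \<delta>)"
        then have ne: "\<delta> \<cdot> w \<noteq> nul Y (To A)" using \<delta> Y_def by simp
        obtain u where u: "arr u" "src u = A" "tgt u = A'" "Tm u \<cdot> (\<delta> \<cdot> w) = \<eta>"
          by (rule ar_factor_out[OF t _ _ _ \<delta>(3) ne]) (use \<delta> w Y_def in simp_all)
        have "Tm u \<cdot> \<delta> = nul D (To A')" using out u A' \<delta>(4) unfolding ghost_out_def by metis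
        then have "\<eta> = nul D (To A') \<cdot> w"
          using comp_eq_left[of "Tm u" \<delta> "nul D (To A')" w] u \<delta> w by simp
        then have "\<eta> = nul Y (To A')" using w ta \<delta> Y_def arr_obj[of w] by simp
        then show False using ar_connecting_nonzero[OF t] by simp
      qed
      then show "\<delta> \<cdot> v = nul (src v) (tgt \<delta>)"
        using direct_sum_comp_zero_src[OF As(1) \<delta>(1), of v] v by blast
    qed
  next
    assume inn: "ghost_in X \<delta>"
    show "ghost_out X A \<delta>" unfolding ghost_out_def
    proof (intro allI impI)
      fix u assume u: "arr u" "src u = A" "tgt u \<in> X"
      \<comment> \<open>This is the other inclusion: objects of \<open>X\<close> are translates of
        objects of \<open>X\<close>, so each summand of \<open>tgt u\<close> starts an
        Auslander-Reiten triangle that ends in \<open>X\<close>.\<close>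
      then have "tgt u \<in> tau_image X" using tau by simp
      then obtain S As Ds where S: "S \<in> X" "direct_sum As (tgt u)" "direct_sum Ds S"
          "list_all2 (\<lambda>A' D'. \<exists>B f g h. ar_triangle A' B D' f g h) As Ds"
        unfolding tau_image_def AR_translate_def by blast
      have "Tm w \<cdot> \<delta> = nul (src \<delta>) (To (tgt w))"
        if w: "arr w" "src w = A" "tgt w \<in> set As" for w
      proof (rule ccontr)
        define Y where "Y = tgt w"
        have YO: "Y \<in> Obj" using w Y_def by simp
        obtain W B' \<alpha> \<beta> \<eta> where W: "W \<in> set Ds" and t: "ar_triangle Y B' W \<alpha> \<beta> \<eta>"
          using S(4) w(3) unfolding Y_def list_all2_conv_all_nth by (metis in_set_conv_nth)
        have WX: "W \<in> X" using direct_sum_subcategory[OF S(3) X] S(1) W by blast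
        have t': "tri Y B' W \<alpha> \<beta> \<eta>" using t ar_triangle_def by auto
        note ta = tri_arr[OF t']
        assume "Tm w \<cdot> \<delta> \<noteq> nul (src \<delta>) (To (tgt w))"
        then have ne: "Tm w \<cdot> \<delta> \<noteq> nul D (To Y)" using \<delta> Y_def by simp
        obtain x where x: "arr x" "src x = W" "tgt x = D" "(Tm w \<cdot> \<delta>) \<cdot> x = \<eta>"
          by (rule ar_factor_in[OF t _ _ _ ne]) (use \<delta> w Y_def in simp_all)
        have "\<delta> \<cdot> x = nul W (To A)" using inn x WX \<delta> unfolding ghost_in_def by metis
        then have "\<eta> = nul W (To Y)" using x w \<delta> ta Y_def by simp
        then show False using ar_connecting_nonzero[OF t] by simp
      qed
      then show "Tm u \<cdot> \<delta> = nul (src \<delta>) (To (tgt u))"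
        using direct_sum_comp_zero_tgt[OF S(2) \<delta>(1,2), of u] u by blast
    qed
  }
qed

end

section \<open>The relative extriangulated structure\<close>

lemma (in preadditive_category) seq_class_refl:
  assumes "arr x" "arr y" "src x = A" "tgt x = B" "src y = B" "tgt y = D"
  shows "(B, x, y) \<in> seq_class A D (B, x, y)"
proof -
  have "A \<in> Obj" "B \<in> Obj" "D \<in> Obj" using assms arr_obj by blast+
  then show ?thesis
    using assms iso_idn[of B] unfolding seq_class_def seq_equiv_def
    by (auto intro!: exI[of _ "idn B"])
qed

text \<open>Auslander-Reiten theory enters only through the assumption
  \<open>ghost_out_iff_in\<close>.\<close>

locale relative_triangulated_category = triangulated_category C To Tm tri
  for C :: "('k, 'o, 'm) lincat" and To :: "'o \<Rightarrow> 'o" and Tm :: "'m \<Rightarrow> 'm"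
  and tri :: "'o \<Rightarrow> 'o \<Rightarrow> 'o \<Rightarrow> 'm \<Rightarrow> 'm \<Rightarrow> 'm \<Rightarrow> bool" +
  fixes X :: "'o set"
  assumes X_subcategory: "subcategory X"
    and X_functorially_finite: "functorially_finite X"
    and ghost_out_iff_in:
      "arr \<delta> \<Longrightarrow> tgt \<delta> = To A \<Longrightarrow> A \<in> Obj \<Longrightarrow> ghost_out X A \<delta> \<longleftrightarrow> ghost_in X \<delta>"
begin

abbreviation "E \<equiv> relative_extri X"

sublocale extri_data C E .

lemma X_obj: "X \<subseteq> Obj"
  using X_subcategory unfolding subcategory_def by blast

lemma Exts_iff:
  assumes "A \<in> Obj" "D \<in> Obj"
  shows "\<delta> \<in> Exts D A \<longleftrightarrow> arr \<delta> \<and> src \<delta> = D \<and> tgt \<delta> = To A \<and> ghost_in X \<delta>"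
proof -
  have "\<delta> \<in> Exts D A \<longleftrightarrow>
      arr \<delta> \<and> src \<delta> = D \<and> tgt \<delta> = To A \<and> (\<exists>B f g. tri A B D f g \<delta> \<and> X_monic X A B f)"
    using assms unfolding relative_extri_def by simp
  moreover have "(\<exists>B f g. tri A B D f g \<delta> \<and> X_monic X A B f) \<longleftrightarrow> ghost_in X \<delta>"
    if "arr \<delta>" "src \<delta> = D" "tgt \<delta> = To A"
    using X_monic_iff_ghost_out[OF _ X_obj] ghost_out_iff_in[OF that(1,3) assms(1)]
      tri_exists[OF that assms(1)] by metis
  ultimately show ?thesis by blast
qed

lemma Ext_simps [simp]:
  "mult (Ext E D A) = add (Mor C D (To A))" "\<one>\<^bsub>Ext E D A\<^esub> = nul D (To A)"
  "push E D a \<delta> = Tm a \<cdot> \<delta>" "pull E c A \<delta> = \<delta> \<cdot> c"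
  by (simp_all add: relative_extri_def shifted_hom_group_def)

text \<open>Triangles are closed under isomorphism, so the union of classes in the realization adds
  nothing to the triangles on \<delta>.\<close>

lemma rlz_eq:
  assumes "A \<in> Obj" "D \<in> Obj"
  shows "rlz E D A \<delta> = {(B, f, g). tri A B D f g \<delta>}"
proof -
  have "(B', f', g') \<in> seq_class A D (B, f, g) \<Longrightarrow> tri A B' D f' g' \<delta>"
    if t: "tri A B D f g \<delta>" for B f g B' f' g'
  proof -
    assume "(B', f', g') \<in> seq_class A D (B, f, g)"
    then obtain b where *: "B' \<in> Obj" "f' \<in> Hom A B'" "g' \<in> Hom B' D" "iso_mor B B' b" "b \<cdot> f = f'"
        "g' \<cdot> b = g"
      unfolding seq_class_def seq_equiv_def by auto
    note ta = tri_arr[OF t]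
    show ?thesis by (rule tri_iso[OF t iso_idn *(4) iso_idn]) (use * ta in simp_all)
  qed
  moreover have "(B, f, g) \<in> seq_class A D (B, f, g)" if t: "tri A B D f g \<delta>" for B f g
    by (rule seq_class_refl) (use tri_arr[OF t] in simp_all)
  ultimately show ?thesis unfolding relative_extri_def by fastforce
qed

text \<open>Any two triangles on the same \<delta> are linked by an isomorphism of middle terms, so
  the union is a single class, as ET2 requires.\<close>

lemma rlz_seq_class:
  assumes t: "tri A B D f g \<delta>"
  shows "rlz E D A \<delta> = seq_class A D (B, f, g)"
proof -
  note ta = tri_arr[OF t]
  have "(B', f', g') \<in> seq_class A D (B, f, g)" if t': "tri A B' D f' g' \<delta>" for B' f' g'
  proof -
    note ta' = tri_arr[OF t']
    obtain b where b: "arr b" "src b = B" "tgt b = B'" "b \<cdot> f = f' \<cdot> idn A" "idn D \<cdot> g = g' \<cdot> b"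
      by (rule tri_mor_13[OF t t', of "idn A" "idn D"]) (use ta in simp_all)
    then have "b \<cdot> f = f'" "g' \<cdot> b = g" using ta ta' by simp_all
    moreover from this have "iso_mor B B' b" by (intro tri_middle_iso[OF t t'] b(1-3))
    ultimately show ?thesis unfolding seq_class_def seq_equiv_def using ta ta' by auto
  qed
  moreover have "seq_class A D (B, f, g) \<subseteq> rlz E D A \<delta>"
    using t unfolding relative_extri_def by auto
  ultimately show ?thesis unfolding rlz_eq[OF ta(1,3)] by blast
qed

lemma E_triangle_iff: "E_triangle A B D x y \<delta> \<longleftrightarrow> tri A B D x y \<delta> \<and> ghost_in X \<delta>"
proof (cases "tri A B D x y \<delta>")
  case True
  note ta = tri_arr[OF True]
  have "(B, x, y) \<in> rlz E D A \<delta>" unfolding rlz_eq[OF ta(1,3)] using True by simp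
  moreover have "\<delta> \<in> Exts D A \<longleftrightarrow> ghost_in X \<delta>" unfolding Exts_iff[OF ta(1,3)] using ta by simp
  ultimately show ?thesis unfolding E_triangle_def using True ta(1,3) by blast
next
  case False
  then have "\<not> E_triangle A B D x y \<delta>" unfolding E_triangle_def using rlz_eq[of A D \<delta>] by auto
  then show ?thesis using False by blast
qed

lemma E_triangleD:
  assumes "E_triangle A B D x y \<delta>"
  shows "tri A B D x y \<delta>" "ghost_in X \<delta>"
  using assms E_triangle_iff by auto

text \<open>This and the next lemma make the extension groups stable under pull-back and
  push-forward.\<close>

lemma ghost_in_comp:
  assumes "ghost_in X \<delta>" "arr \<delta>" "arr c" "tgt c = src \<delta>"
  shows "ghost_in X (\<delta> \<cdot> c)"
  unfolding ghost_in_def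
proof (intro allI impI)
  fix v assume v: "arr v" "src v \<in> X" "tgt v = src (\<delta> \<cdot> c)"
  have "\<delta> \<cdot> (c \<cdot> v) = nul (src (c \<cdot> v)) (tgt \<delta>)"
    by (rule assms(1)[unfolded ghost_in_def, rule_format]) (use v assms(2-4) in simp_all)
  then show "(\<delta> \<cdot> c) \<cdot> v = nul (src v) (tgt (\<delta> \<cdot> c))" using v assms(2-4) by simp
qed

lemma ghost_in_T_comp:
  assumes g: "ghost_in X \<delta>" and "arr \<delta>" "arr a" "tgt \<delta> = To (src a)"
  shows "ghost_in X (Tm a \<cdot> \<delta>)"
  unfolding ghost_in_def
proof (intro allI impI)
  fix v assume v: "arr v" "src v \<in> X" "tgt v = src (Tm a \<cdot> \<delta>)"
  have "\<delta> \<cdot> v = nul (src v) (tgt \<delta>)"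
    by (rule g[unfolded ghost_in_def, rule_format]) (use v assms(2-4) in simp_all)
  then show "(Tm a \<cdot> \<delta>) \<cdot> v = nul (src v) (tgt (Tm a \<cdot> \<delta>))" using v assms by simp
qed

lemma Exts_abelian: "A \<in> Obj \<Longrightarrow> D \<in> Obj \<Longrightarrow> comm_group (Ext E D A)"
proof (rule comm_groupI)
  assume "A \<in> Obj" "D \<in> Obj"
  note [simp] = this Exts_iff[OF this]
  show "\<one>\<^bsub>Ext E D A\<^esub> \<in> Exts D A" by (simp add: ghost_in_def)
  fix x assume x: "x \<in> Exts D A"
  then show "\<one>\<^bsub>Ext E D A\<^esub> \<otimes>\<^bsub>Ext E D A\<^esub> x = x" by simp
  show "\<exists>y\<in>Exts D A. y \<otimes>\<^bsub>Ext E D A\<^esub> x = \<one>\<^bsub>Ext E D A\<^esub>"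
    by (rule bexI[of _ "neg x"]) (use x in \<open>auto simp: ghost_in_def\<close>)
  fix y assume y: "y \<in> Exts D A"
  show "x \<otimes>\<^bsub>Ext E D A\<^esub> y \<in> Exts D A" using x y by (simp add: ghost_in_def)
  show "x \<otimes>\<^bsub>Ext E D A\<^esub> y = y \<otimes>\<^bsub>Ext E D A\<^esub> x" using x y plus_comm[of x y] by simp
  fix z assume z: "z \<in> Exts D A"
  show "x \<otimes>\<^bsub>Ext E D A\<^esub> y \<otimes>\<^bsub>Ext E D A\<^esub> z = x \<otimes>\<^bsub>Ext E D A\<^esub> (y \<otimes>\<^bsub>Ext E D A\<^esub> z)"
    using x y z plus_assoc[of x y z] by simp
qed

text \<open>The octahedral axiom supplies all data; it remains to see that \<delta>'' and the pushed
  extension are ghosts.\<close>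

lemma E_triangle_ET4:
  assumes E: "E_triangle A B D f f' \<delta>" "E_triangle B G F g g' \<delta>'"
  shows "\<exists>H\<in>Obj. \<exists>h'\<in>Hom G H. \<exists>d\<in>Hom D H. \<exists>e\<in>Hom H F. \<exists>\<delta>''.
    h' \<cdot> g = d \<cdot> f' \<and> e \<cdot> h' = g' \<and>
    E_triangle A G H (g \<cdot> f) h' \<delta>'' \<and> E_triangle D H F d e (push E F f' \<delta>') \<and>
    pull E d A \<delta>'' = \<delta> \<and> push E H f \<delta>'' = pull E e B \<delta>'"
proof -
  note t = E_triangleD(1)[OF E(1)] E_triangleD(1)[OF E(2)]
  note ta = tri_arr[OF t(1)] tri_arr[OF t(2)]
  obtain H h' \<delta>'' where t'': "tri A G H (g \<cdot> f) h' \<delta>''" using TR1_cone[of A G "g \<cdot> f"] ta by auto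
  note ta'' = tri_arr[OF t'']
  obtain u v where u: "u \<in> Hom D H" and v: "v \<in> Hom H F" and uv: "tri D H F u v (Tm f' \<cdot> \<delta>')"
      "u \<cdot> f' = h' \<cdot> g" "v \<cdot> h' = g'" "\<delta>'' \<cdot> u = \<delta>" "\<delta>' \<cdot> v = Tm f \<cdot> \<delta>''"
    using TR4[OF t t''] by blast
  \<comment> \<open>The ghost condition is expressed through the first maps, because
    \<open>X\<close>-monic morphisms visibly compose.\<close>
  have m: "X_monic X A B f" "X_monic X B G g"
    using E_triangleD[OF E(1)] E_triangleD[OF E(2)] X_monic_iff_ghost_out[OF t(1) X_obj]
      X_monic_iff_ghost_out[OF t(2) X_obj] ghost_out_iff_in ta by auto
  have "(\<lambda>v. v \<cdot> (g \<cdot> f)) ` Hom G Y = Hom A Y" if Y: "Y \<in> X" for Y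
  proof -
    have YO: "Y \<in> Obj" using Y X_obj by blast
    have "(\<lambda>v. v \<cdot> (g \<cdot> f)) ` Hom G Y = (\<lambda>v. v \<cdot> f) ` ((\<lambda>v. v \<cdot> g) ` Hom G Y)"
      using ta YO by (auto simp: image_image intro!: image_cong)
    also have "\<dots> = Hom A Y" using m Y unfolding X_monic_def by simp
    finally show ?thesis .
  qed
  then have "X_monic X A G (g \<cdot> f)" unfolding X_monic_def using ta by simp
  then have "ghost_in X \<delta>''"
    using X_monic_iff_ghost_out[OF t'' X_obj] ghost_out_iff_in ta'' by simp
  moreover have "ghost_in X (Tm f' \<cdot> \<delta>')"
    using ghost_in_T_comp[OF E_triangleD(2)[OF E(2)]] ta by simp
  ultimately show ?thesis
    unfolding E_triangle_iff Ext_simps using t'' uv u v ta'' ta by (metis hom_iff)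
qed

text \<open>The octahedral axiom for \<open>f\<close> and \<open>g\<close>, rotated back.\<close>

lemma E_triangle_ET4_op:
  assumes E: "E_triangle D A B f' f \<delta>" "E_triangle F B G g' g \<delta>'"
  shows "\<exists>H\<in>Obj. \<exists>d\<in>Hom D H. \<exists>e\<in>Hom H F. \<exists>h'\<in>Hom H A. \<exists>\<delta>''.
    h' \<cdot> d = f' \<and> f \<cdot> h' = g' \<cdot> e \<and>
    E_triangle H A G h' (g \<cdot> f) \<delta>'' \<and> E_triangle D H F d e (pull E g' D \<delta>) \<and>
    push E G e \<delta>'' = \<delta>' \<and> push E B d \<delta> = pull E g H \<delta>''"
proof -
  note t = E_triangleD(1)[OF E(1)] E_triangleD(1)[OF E(2)]
  note ta = tri_arr[OF t(1)] tri_arr[OF t(2)]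
  obtain H h' \<delta>'' where t'': "tri H A G h' (g \<cdot> f) \<delta>''"
    by (rule tri_exists_left[of "g \<cdot> f" A G]) (use ta in simp_all)
  note ta'' = tri_arr[OF t'']
  \<comment> \<open>The third triangle of the octahedron lives on shifted objects; \<open>u\<close>
    and \<open>v\<close> are then written as shifts of \<open>d\<close> and
    \<open>e\<close>.\<close>
  obtain u v where "u \<in> Hom (To D) (To H)" "v \<in> Hom (To H) (To F)"
    and uv: "tri (To D) (To H) (To F) u v (Tm \<delta> \<cdot> neg (Tm g'))"
      "u \<cdot> \<delta> = \<delta>'' \<cdot> g" "v \<cdot> \<delta>'' = \<delta>'" "neg (Tm h') \<cdot> u = neg (Tm f')"
      "neg (Tm g') \<cdot> v = Tm f \<cdot> neg (Tm h')"
    using TR4[OF tri_rotate1[OF t(1)] tri_rotate1[OF t(2)] tri_rotate1[OF t'']] by blast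
  then have ua: "arr u" "src u = To D" "tgt u = To H" and va: "arr v" "src v = To H" "tgt v = To F"
    using ta ta'' by simp_all
  obtain d where d: "arr d" "src d = D" "tgt d = H" and ud: "u = Tm d"
    using T_full[OF ua] ta ta'' by metis
  obtain e where e: "arr e" "src e = H" "tgt e = F" and ve: "v = Tm e"
    using T_full[OF va] ta ta'' by metis
  have "neg (Tm (h' \<cdot> d)) = neg (Tm f')" "neg (Tm (g' \<cdot> e)) = neg (Tm (f \<cdot> h'))"
    using uv(4,5) d e ta ta'' unfolding ud ve by simp_all
  then have "Tm (h' \<cdot> d) = Tm f'" "Tm (f \<cdot> h') = Tm (g' \<cdot> e)"
    using d e ta ta'' neg_inject[of "Tm (h' \<cdot> d)" "Tm f'"]
      neg_inject[of "Tm (g' \<cdot> e)" "Tm (f \<cdot> h')"] by simp_all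
  then have hd: "h' \<cdot> d = f'" and fh: "f \<cdot> h' = g' \<cdot> e"
    using T_faithful[of "h' \<cdot> d" f'] T_faithful[of "f \<cdot> h'" "g' \<cdot> e"] d e ta ta'' by simp_all
  have de: "tri D H F d e (\<delta> \<cdot> g')"
    by (rule tri_rotate3) (use uv(1) d e ta ta'' ud ve in simp_all)
  \<comment> \<open>A morphism from \<open>X\<close> lifts first through \<open>g\<close>, then
    through \<open>f\<close>, since \<delta>' and \<delta> are ghosts; and \<delta>'' kills
    \<open>g \<cdot> f\<close>.\<close>
  have "ghost_in X \<delta>''" unfolding ghost_in_def
  proof (intro allI impI)
    fix v assume v: "arr v" "src v \<in> X" "tgt v = src \<delta>''"
    define W where "W = src v"
    note v = v[folded W_def] W_def[symmetric]
    have WO: "W \<in> Obj" using v X_obj by blast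
    have "\<delta>' \<cdot> v = nul W (To F)" "v \<in> Hom W G"
      using E_triangleD(2)[OF E(2)] v ta ta'' WO unfolding ghost_in_def by auto
    then obtain v' where v': "arr v'" "src v' = W" "tgt v' = B" "g \<cdot> v' = v"
      using tri_factor_3[OF t(2), of v W] v ta'' by metis
    have "\<delta> \<cdot> v' = nul W (To D)" using E_triangleD(2)[OF E(1)] v v' ta unfolding ghost_in_def by auto
    then obtain w where w: "arr w" "src w = W" "tgt w = A" "f \<cdot> w = v'"
      using tri_factor_3[OF t(1), of v' W] v' by metis
    have "\<delta>'' \<cdot> v = (\<delta>'' \<cdot> (g \<cdot> f)) \<cdot> w" using w v' ta ta'' by simp
    then show "\<delta>'' \<cdot> v = nul (src v) (tgt \<delta>'')"
      unfolding tri_comp_zero_2[OF t''] using w ta'' v(4) by simp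
  qed
  moreover have "ghost_in X (\<delta> \<cdot> g')"
    using ghost_in_comp[OF E_triangleD(2)[OF E(1)], of g'] ta by simp
  ultimately show ?thesis
    unfolding E_triangle_iff Ext_simps
    using t'' uv(2,3) hd fh de ud ve d e ta'' ta by (metis hom_iff)
qed

text \<open>Push and pull are compositions, so ET1 is bilinearity together with the closure of
  ghosts. The other axioms are the completion, sum and octahedral results for triangles.\<close>

theorem extriangulated: "extriangulated_category C E"
proof (rule extriangulated_category.intro[OF additive_category_axioms],
    rule extriangulated_category_axioms.intro)
  fix A D :: 'o assume "D \<in> Obj" "A \<in> Obj"
  then show "comm_group (Ext E D A)" by (simp add: Exts_abelian)
next
  fix A A' D a assume "D \<in> Obj" "A \<in> Obj" "A' \<in> Obj" "a \<in> Hom A A'"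
  then show "push E D a \<in> hom (Ext E D A) (Ext E D A')"
    by (auto simp: hom_def Exts_iff ghost_in_T_comp)
next
  fix A D D' c assume "D \<in> Obj" "D' \<in> Obj" "A \<in> Obj" "c \<in> Hom D' D"
  then show "pull E c A \<in> hom (Ext E D A) (Ext E D' A)"
    by (auto simp: hom_def Exts_iff ghost_in_comp)
next
  fix A D \<delta> assume "D \<in> Obj" "A \<in> Obj" "\<delta> \<in> Exts D A"
  then show "push E D (idn A) \<delta> = \<delta>" "pull E (idn D) A \<delta> = \<delta>" by (simp_all add: Exts_iff)
next
  fix A A' A'' D a a' \<delta>
  assume "D \<in> Obj" "A \<in> Obj" "A' \<in> Obj" "A'' \<in> Obj" "a \<in> Hom A A'" "a' \<in> Hom A' A''" "\<delta> \<in> Exts D A"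
  then show "push E D (a' \<cdot> a) \<delta> = push E D a' (push E D a \<delta>)" by (simp add: Exts_iff)
next
  fix A D D' D'' c c' \<delta>
  assume "D \<in> Obj" "D' \<in> Obj" "D'' \<in> Obj" "A \<in> Obj" "c \<in> Hom D' D" "c' \<in> Hom D'' D'" "\<delta> \<in> Exts D A"
  then show "pull E (c \<cdot> c') A \<delta> = pull E c' A (pull E c A \<delta>)" by (simp add: Exts_iff)
next
  fix A A' D D' a c \<delta>
  assume "D \<in> Obj" "D' \<in> Obj" "A \<in> Obj" "A' \<in> Obj" "a \<in> Hom A A'" "c \<in> Hom D' D" "\<delta> \<in> Exts D A"
  then show "push E D' a (pull E c A \<delta>) = pull E c A' (push E D a \<delta>)" by (simp add: Exts_iff)
next
  fix A A' D a a' \<delta>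
  assume "D \<in> Obj" "A \<in> Obj" "A' \<in> Obj" "a \<in> Hom A A'" "a' \<in> Hom A A'" "\<delta> \<in> Exts D A"
  then show "push E D (a \<oplus>\<^bsub>Mor C A A'\<^esub> a') \<delta> = push E D a \<delta> \<otimes>\<^bsub>Ext E D A'\<^esub> push E D a' \<delta>"
    by (simp add: Exts_iff)
next
  fix A D D' c c' \<delta>
  assume "D \<in> Obj" "D' \<in> Obj" "A \<in> Obj" "c \<in> Hom D' D" "c' \<in> Hom D' D" "\<delta> \<in> Exts D A"
  then show "pull E (c \<oplus>\<^bsub>Mor C D' D\<^esub> c') A \<delta> = pull E c A \<delta> \<otimes>\<^bsub>Ext E D' A\<^esub> pull E c' A \<delta>"
    by (simp add: Exts_iff)
next
  fix A D \<delta> assume *: "D \<in> Obj" "A \<in> Obj" "\<delta> \<in> Exts D A"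
  then have "arr \<delta>" "src \<delta> = D" "tgt \<delta> = To A" using Exts_iff by auto
  then obtain B x y where t: "tri A B D x y \<delta>" using tri_exists * by blast
  show "\<exists>B\<in>Obj. \<exists>x\<in>Hom A B. \<exists>y\<in>Hom B D. rlz E D A \<delta> = seq_class A D (B, x, y)"
    using rlz_seq_class[OF t] tri_typed[OF t] by blast
next
  fix A B D x y \<delta> A' B' D' x' y' \<delta>' a c
  assume E: "E_triangle A B D x y \<delta>" "E_triangle A' B' D' x' y' \<delta>'"
    and ac: "a \<in> Hom A A'" "c \<in> Hom D D'" "push E D a \<delta> = pull E c A' \<delta>'"
  note t = E_triangleD(1)[OF E(1)] E_triangleD(1)[OF E(2)]
  note ta = tri_arr[OF t(1)] tri_arr[OF t(2)]
  obtain b where "arr b" "src b = B" "tgt b = B'" "b \<cdot> x = x' \<cdot> a" "c \<cdot> y = y' \<cdot> b"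
    by (rule tri_mor_13[OF t, of a c]) (use ac ta in simp_all)
  then show "\<exists>b\<in>Hom B B'. b \<cdot> x = x' \<cdot> a \<and> y' \<cdot> b = c \<cdot> y" using ta by auto
next
  fix A D S i j p q assume b: "biproduct A D S i j p q"
  show "rlz E D A \<one>\<^bsub>Ext E D A\<^esub> = seq_class A D (S, i, q)"
    using rlz_seq_class[OF tri_split[OF b]] by simp
next
  fix A B D x y \<delta> A' B' D' x' y' \<delta>' SA iA jA pA qA SB iB jB pB qB SD iD jD pD qD
  assume E: "E_triangle A B D x y \<delta>" "E_triangle A' B' D' x' y' \<delta>'"
    and b: "biproduct A A' SA iA jA pA qA" "biproduct B B' SB iB jB pB qB"
      "biproduct D D' SD iD jD pD qD"
  note t = E_triangleD(1)[OF E(1)] E_triangleD(1)[OF E(2)]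
  note ta = tri_arr[OF t(1)] tri_arr[OF t(2)]
  have "sum_ext A A' SA iA jA SD pD qD \<delta> \<delta>' = Tm iA \<cdot> \<delta> \<cdot> pD \<boxplus> Tm jA \<cdot> \<delta>' \<cdot> qD"
    using ta biproduct_arr[OF b(1)] biproduct_arr[OF b(3)] by simp
  then show "rlz E SD SA (sum_ext A A' SA iA jA SD pD qD \<delta> \<delta>')
      = seq_class SA SD (SB, sum_mor SA SB iB jB pA qA x x', sum_mor SB SD iD jD pB qB y y')"
    using rlz_seq_class[OF tri_sum[OF t b]] by (simp only:)
next
  fix A B D x y \<delta> A' B' D' x' y' \<delta>' a b
  assume E: "E_triangle A B D x y \<delta>" "E_triangle A' B' D' x' y' \<delta>'"
    and ab: "a \<in> Hom A A'" "b \<in> Hom B B'" "b \<cdot> x = x' \<cdot> a"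
  note t = E_triangleD(1)[OF E(1)] E_triangleD(1)[OF E(2)]
  show "\<exists>c\<in>Hom D D'. push E D a \<delta> = pull E c A' \<delta>' \<and> c \<cdot> y = y' \<cdot> b"
    using TR3[OF t ab] by auto
next
  fix A B D x y \<delta> A' B' D' x' y' \<delta>' b c
  assume E: "E_triangle A B D x y \<delta>" "E_triangle A' B' D' x' y' \<delta>'"
    and bc: "b \<in> Hom B B'" "c \<in> Hom D D'" "c \<cdot> y = y' \<cdot> b"
  note t = E_triangleD(1)[OF E(1)] E_triangleD(1)[OF E(2)]
  note ta = tri_arr[OF t(1)] tri_arr[OF t(2)]
  obtain a where "arr a" "src a = A" "tgt a = A'" "b \<cdot> x = x' \<cdot> a" "Tm a \<cdot> \<delta> = \<delta>' \<cdot> c"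
    by (rule tri_mor_23[OF t, of b c]) (use bc ta in simp_all)
  then show "\<exists>a\<in>Hom A A'. push E D a \<delta> = pull E c A' \<delta>' \<and> b \<cdot> x = x' \<cdot> a" using ta by auto
qed (rule E_triangle_ET4 E_triangle_ET4_op; assumption)+

section \<open>Projective and injective objects\<close>

lemma X_projective:
  assumes "P \<in> X"
  shows "projective P"
  unfolding projective_def
proof (intro conjI allI impI ballI)
  show P: "P \<in> Obj" using assms X_obj by blast
  fix A B D x y \<delta> u assume E: "E_triangle A B D x y \<delta>" and "u \<in> Hom P D"
  note t = E_triangleD(1)[OF E]
  note ta = tri_arr[OF t]
  have u: "arr u" "src u = P" "tgt u = D" using \<open>u \<in> Hom P D\<close> P ta by auto
  then have "\<delta> \<cdot> u = nul P (To A)" using E_triangleD(2)[OF E] assms ta unfolding ghost_in_def by auto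
  then obtain v where "arr v" "src v = P" "tgt v = B" "y \<cdot> v = u"
    by (rule tri_factor_3[OF t u])
  then show "\<exists>v\<in>Hom P B. u = y \<cdot> v" using P ta by auto
qed

lemma X_injective:
  assumes "I \<in> X"
  shows "injective I"
  unfolding injective_def
proof (intro conjI allI impI ballI)
  show I: "I \<in> Obj" using assms X_obj by blast
  fix A B D x y \<delta> u assume E: "E_triangle A B D x y \<delta>" and "u \<in> Hom A I"
  note t = E_triangleD(1)[OF E]
  note ta = tri_arr[OF t]
  have u: "arr u" "src u = A" "tgt u = I" using \<open>u \<in> Hom A I\<close> I ta by auto
  have "ghost_out X A \<delta>" using E_triangleD(2)[OF E] ghost_out_iff_in ta by simp
  then have "Tm u \<cdot> \<delta> = nul D (To I)" using u assms ta unfolding ghost_out_def by auto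
  then obtain v where "arr v" "src v = B" "tgt v = I" "v \<cdot> x = u"
    by (rule tri_factor_0[OF t u])
  then show "\<exists>v\<in>Hom B I. u = v \<cdot> x" using I ta by auto
qed

text \<open>A right approximation is completed to a triangle. Morphisms from \<open>X\<close> factor
  through it, and the connecting morphism kills it.\<close>

lemma enough_X_right:
  assumes D: "D \<in> Obj"
  obtains A Y x y \<delta> where "Y \<in> X" "E_triangle A Y D x y \<delta>"
proof -
  obtain Y y where r: "right_approx X D Y y"
    using X_functorially_finite D unfolding functorially_finite_def by blast
  then have Y: "Y \<in> X" "Y \<in> Obj" using X_obj unfolding right_approx_def by auto
  then have y: "arr y" "src y = Y" "tgt y = D" using r D unfolding right_approx_def by auto
  obtain A x \<delta> where t: "tri A Y D x y \<delta>" using tri_exists_left[OF y] .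
  note ta = tri_arr[OF t]
  have "ghost_in X \<delta>" unfolding ghost_in_def
  proof (intro allI impI)
    fix v assume v: "arr v" "src v \<in> X" "tgt v = src \<delta>"
    then have "v \<in> Hom (src v) D" using ta arr_hom by metis
    then obtain w where w: "w \<in> Hom (src v) Y" "v = y \<cdot> w"
      using r v unfolding right_approx_def by blast
    then have wa: "arr w" "src w = src v" "tgt w = Y" using v Y by simp_all
    have "\<delta> \<cdot> v = (\<delta> \<cdot> y) \<cdot> w" using w(2) wa ta by (metis assoc)
    also have "\<dots> = nul (src v) (tgt \<delta>)" unfolding tri_comp_zero_2[OF t] using wa ta Y by simp
    finally show "\<delta> \<cdot> v = nul (src v) (tgt \<delta>)" .
  qed
  then show ?thesis using that Y t E_triangle_iff by blast
qed

text \<open>The defining property of a left approximation is that it is \<open>X\<close>-monic, so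
  its triangle is a relative one.\<close>

lemma enough_X_left:
  assumes A: "A \<in> Obj"
  obtains D Y x y \<delta> where "Y \<in> X" "E_triangle A Y D x y \<delta>"
proof -
  obtain Y x where l: "left_approx X A Y x"
    using X_functorially_finite A unfolding functorially_finite_def by blast
  then have Y: "Y \<in> X" "Y \<in> Obj" using X_obj unfolding left_approx_def by auto
  then have x: "x \<in> Hom A Y" using l unfolding left_approx_def by auto
  obtain D y \<delta> where t: "tri A Y D x y \<delta>" using TR1_cone[OF A Y(2) x] by blast
  note ta = tri_arr[OF t]
  have "v \<cdot> x \<in> Hom A Z" if "Z \<in> X" "v \<in> Hom Y Z" for v Z
    using comp_closed[OF A Y(2) _ x that(2)] that X_obj by blast
  then have "(\<lambda>v. v \<cdot> x) ` Hom Y Z = Hom A Z" if "Z \<in> X" for Z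
    using l that unfolding left_approx_def by blast
  then have "X_monic X A Y x" unfolding X_monic_def using x by blast
  then have "ghost_in X \<delta>" using X_monic_iff_ghost_out[OF t X_obj] ghost_out_iff_in ta by simp
  then show ?thesis using that Y t E_triangle_iff by blast
qed

text \<open>The middle term is then a biproduct of the ends, and \<open>X\<close> is closed under
  direct summands.\<close>

lemma zero_extension_ends_in_X:
  assumes "tri A Y D x y (nul D (To A))" "Y \<in> X"
  shows "A \<in> X" "D \<in> X"
  using tri_zero_biproduct[OF assms(1)] assms(2) X_subcategory unfolding subcategory_def by blast+

text \<open>For a projective \<open>P\<close> the identity lifts through an approximation, so the
  approximation triangle splits and \<open>P\<close> is a summand of an object of
  \<open>X\<close>.\<close>

lemma projective_iff: "projective P \<longleftrightarrow> P \<in> X"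
proof
  assume pr: "projective P"
  then have P: "P \<in> Obj" unfolding projective_def by blast
  obtain A Y x y \<delta> where Y: "Y \<in> X" and E: "E_triangle A Y P x y \<delta>" using enough_X_right[OF P] .
  note t = E_triangleD(1)[OF E]
  note ta = tri_arr[OF t]
  obtain s where "s \<in> Hom P Y" "idn P = y \<cdot> s" using pr E id_closed[OF P] unfolding projective_def by blast
  then have s: "arr s" "src s = P" "tgt s = Y" "y \<cdot> s = idn P" using P ta by auto
  have "\<delta> = (\<delta> \<cdot> y) \<cdot> s" using s ta by simp
  also have "\<dots> = nul P (To A)" unfolding tri_comp_zero_2[OF t] using s ta by simp
  finally show "P \<in> X" using zero_extension_ends_in_X t Y by blast
qed (rule X_projective)

lemma injective_iff: "injective I \<longleftrightarrow> I \<in> X"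
proof
  assume inj: "injective I"
  then have I: "I \<in> Obj" unfolding injective_def by blast
  obtain D Y x y \<delta> where Y: "Y \<in> X" and E: "E_triangle I Y D x y \<delta>" using enough_X_left[OF I] .
  note t = E_triangleD(1)[OF E]
  note ta = tri_arr[OF t]
  obtain s where "s \<in> Hom Y I" "idn I = s \<cdot> x" using inj E id_closed[OF I] unfolding injective_def by blast
  then have s: "arr s" "src s = Y" "tgt s = I" "s \<cdot> x = idn I" using I ta by auto
  have "\<delta> = Tm (s \<cdot> x) \<cdot> \<delta>" unfolding s(4) using ta by simp
  also have "\<dots> = Tm s \<cdot> (Tm x \<cdot> \<delta>)" using s(1-3) ta by simp
  also have "\<dots> = nul D (To I)" unfolding tri_comp_zero_3[OF t] using s(1-3) ta by simp
  finally show "I \<in> X" using zero_extension_ends_in_X t Y by blast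
qed (rule X_injective)

lemma frobenius: "frobenius"
  unfolding frobenius_def projective_iff injective_iff
  using enough_X_left enough_X_right by metis

text \<open>In a triangulated category, every object \<open>P\<close> starts a triangle \<open>P \<rightarrow> 0 \<rightarrow> T P\<close>, so an
  injective object is zero.\<close>

lemma not_triangulated:
  assumes "P \<in> X" "\<not> zero_object P"
  shows "\<not> is_triangulated"
proof
  assume "is_triangulated"
  then obtain S Sm tri' \<phi> where S: "triangulated_category C S Sm tri'"
    and \<phi>: "\<forall>D\<in>Obj. \<forall>A\<in>Obj. \<phi> D A \<in> iso (Ext E D A) (shifted_hom_group C S D A)"
    and r: "\<forall>A\<in>Obj. \<forall>D\<in>Obj. \<forall>\<delta>\<in>Exts D A. \<forall>B x y.
      tri' A B D x y (\<phi> D A \<delta>) \<longrightarrow> rlz E D A \<delta> = seq_class A D (B, x, y)"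
    unfolding is_triangulated_def by - (elim exE conjE, rule that, assumption+)
  \<comment> \<open>The shift \<open>S\<close> and the triangles \<open>tri'\<close> are arbitrary;
    no relation to \<open>To\<close> and \<open>tri\<close> is assumed.\<close>
  interpret S: triangulated_category C S Sm tri' by (rule S)
  have P: "P \<in> Obj" using assms X_obj by blast
  obtain Z where Z: "zero_object Z" using has_zero_object by blast
  then have Zo: "Z \<in> Obj" by (simp add: zero_object_def)
  have t: "tri' P Z (S P) (nul P Z) (nul Z (S P)) (neg (Sm (idn P)))"
    by (rule S.tri_rotate1[OF S.tri_idn_zero[OF P Z]])
  note ta = S.tri_arr[OF t]
  \<comment> \<open>Surjectivity of \<phi> turns the last map of this triangle into a relative
    extension \<delta>.\<close>
  have "\<phi> (S P) P \<in> iso (Ext E (S P) P) (shifted_hom_group C S (S P) P)"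
    by (rule bspec[OF bspec[OF \<phi> ta(3)] P])
  then have surj: "\<phi> (S P) P ` Exts (S P) P = Hom (S P) (S P)"
    unfolding iso_def bij_betw_def by (simp only: mem_Collect_eq)
      (simp only: shifted_hom_group_def partial_object.select_convs)
  have "neg (Sm (idn P)) \<in> \<phi> (S P) P ` Exts (S P) P"
    unfolding surj using ta by (simp only: hom_iff)
  then obtain \<delta> where \<delta>: "neg (Sm (idn P)) = \<phi> (S P) P \<delta>" "\<delta> \<in> Exts (S P) P"
    by (rule imageE)
  have "rlz E (S P) P \<delta> = seq_class P (S P) (Z, nul P Z, nul Z (S P))"
    using bspec[OF bspec[OF bspec[OF r P] ta(3)] \<delta>(2)] t unfolding \<delta>(1) by blast
  moreover have "(Z, nul P Z, nul Z (S P)) \<in> seq_class P (S P) (Z, nul P Z, nul Z (S P))"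
    by (rule seq_class_refl) (use ta in simp_all)
  ultimately have "E_triangle P Z (S P) (nul P Z) (nul Z (S P)) \<delta>"
    unfolding E_triangle_def using P ta(3) \<delta>(2) by blast
  then obtain v where "v \<in> Hom Z P" "idn P = v \<cdot> nul P Z"
    using X_injective[OF assms(1)] id_closed[OF P] unfolding injective_def by blast
  then have "zero_object P" using P Zo unfolding zero_object_def by auto
  then show False using assms(2) by simp
qed

text \<open>In an exact category the deflation \<open>Y \<rightarrow> D\<close> obtained from a right approximation of
  \<open>D\<close> is epic, so the connecting morphism, which it kills, vanishes.\<close>

lemma not_exact:
  assumes D: "D \<in> Obj" "D \<notin> X"
  shows "\<not> is_exact"
proof
  assume "is_exact"
  then obtain ses where q: "quillen_exact_category C ses"
    and bij: "\<forall>D\<in>Obj. \<forall>A\<in>Obj. bij_betw (rlz E D A) (Exts D A) (yoneda_ext.Ext1 C ses D A)"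
    unfolding is_exact_def by - (elim exE conjE, rule that, assumption+)
  interpret quillen_exact_category C ses by (rule q)
  obtain A Y x y \<delta> where Y: "Y \<in> X" and E: "E_triangle A Y D x y \<delta>" using enough_X_right[OF D(1)] .
  note t = E_triangleD(1)[OF E]
  note ta = tri_arr[OF t]
  \<comment> \<open>The class is known to come from some admissible sequence; closure under
    isomorphism makes the approximation sequence itself admissible.\<close>
  have "rlz E D A \<delta> \<in> yoneda_ext.Ext1 C ses D A"
    using bspec[OF bspec[OF bij D(1)] ta(1)] E unfolding E_triangle_def bij_betw_def by blast
  then obtain B x' y' where s: "ses A B D x' y'" "rlz E D A \<delta> = seq_class A D (B, x', y')"
    unfolding yoneda_ext.Ext1_def by blast
  then have "(Y, x, y) \<in> seq_class A D (B, x', y')" using E unfolding E_triangle_def by simp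
  then obtain b where b: "x' \<in> Hom A B" "y' \<in> Hom B D" "B \<in> Obj" "iso_mor B Y b" "b \<cdot> x' = x" "y \<cdot> b = y'"
    unfolding seq_class_def seq_equiv_def by auto
  have "ses A Y D x y"
    by (rule ses_iso[OF s(1) _ _ _ _ _ iso_idn b(4) iso_idn]) (use b ta in simp_all)
  then have "kernel_cokernel_pair A Y D x y" by (rule ses_ker_coker)
  then have "\<exists>!v. v \<in> Hom D (To A) \<and> v \<cdot> y = nul Y (To A)"
    unfolding kernel_cokernel_pair_def using ta by auto
  moreover have "\<delta> \<in> Hom D (To A) \<and> \<delta> \<cdot> y = nul Y (To A)"
    "nul D (To A) \<in> Hom D (To A) \<and> nul D (To A) \<cdot> y = nul Y (To A)"
    using tri_comp_zero_2[OF t] ta by simp_all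
  ultimately have "\<delta> = nul D (To A)" by blast
  then show False using zero_extension_ends_in_X t Y D(2) by blast
qed

end

theorem mainTheorem7:
  fixes K :: "('k, 'z) ring_scheme"
    and C :: "('k, 'o, 'm) lincat"
    and To :: "'o \<Rightarrow> 'o" and Tm :: "'m \<Rightarrow> 'm"
    and tri :: "'o \<Rightarrow> 'o \<Rightarrow> 'o \<Rightarrow> 'm \<Rightarrow> 'm \<Rightarrow> 'm \<Rightarrow> bool"
    and X :: "'o set"
    and E' :: "('o, 'm, 'm) extri"
  assumes "linear_krull_schmidt_category K C"
    and "triangulated_category C To Tm tri"
    and "triangle_data.has_AR_translation C tri"
    and "cat_data.subcategory C X"
    and "cat_data.functorially_finite C X"
    and "triangle_data.tau_image C tri X = X"
    and "E' = triangle_data.relative_extri C To Tm tri X"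
  shows "extriangulated_category C E' \<and>
         extri_data.frobenius C E' \<and>
         {P. extri_data.projective C E' P} = X \<and>
         {I. extri_data.injective C E' I} = X \<and>
         (X \<noteq> {Z. cat_data.zero_object C Z} \<longrightarrow> \<not> extri_data.is_triangulated C E') \<and>
         (X \<noteq> Ob C \<longrightarrow> \<not> extri_data.is_exact C E') \<and>
         ({Z. cat_data.zero_object C Z} \<noteq> X \<and> X \<subset> Ob C \<longrightarrow>
            \<not> extri_data.is_exact C E' \<and> \<not> extri_data.is_triangulated C E')"
proof -
  interpret triangulated_category C To Tm tri by (rule assms(2))
  interpret relative_triangulated_category C To Tm tri X
    by unfold_locales
      (use assms(4,5) ghost_out_iff_ghost_in[OF linear_krull_schmidt_category.krull_schmidt[OF assms(1)]
          assms(3,4,6)] in blast)+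
  \<comment> \<open>With this inclusion, \<open>X\<close> being different from the class of zero
    objects yields a nonzero member of \<open>X\<close>.\<close>
  have "{Z. zero_object Z} \<subseteq> X" using X_subcategory unfolding subcategory_def by blast
  then have "X \<noteq> {Z. zero_object Z} \<Longrightarrow> \<not> is_triangulated" using not_triangulated by blast
  moreover have "X \<noteq> Obj \<Longrightarrow> \<not> is_exact" using not_exact X_obj by blast
  ultimately show ?thesis
    unfolding assms(7) using extriangulated frobenius projective_iff injective_iff by auto
qed

end
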